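(* Let $V$ be an $n$-dimensional vector space over a field $\mathbb K$, and let $e\in\mathfrak{gl}(V)$ be a nilpotent element with $k$ Jordan blocks. Assume that $\mathbb K$ contains at least $k$ elements. Let $\mathfrak z(e)$ be the centraliser of $e$ in $\mathfrak{gl}(V)$. Then $\operatorname{ind}\mathfrak z(e)=n$.
   Context: For a finite-dimensional Lie algebra $\mathfrak q$ over $\mathbb K$ and $\alpha\in\mathfrak q^*$, the stabiliser is $\mathfrak q_\alpha=\{\xi\in\mathfrak q:\alpha([\xi,\mathfrak q])=0\}$, and the index is $\operatorname{ind}\mathfrak q=\min_{\alpha\in\mathfrak q^*}\dim\mathfrak q_\alpha$. *)

theory Defs
  imports
    "HOL-Library.Function_Algebras"
    "Jordan_Normal_Form.Jordan_Normal_Form"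
begin

section \<open>Lie algebras and their index\<close>

text \<open>
  A finite-dimensional Lie algebra over the field \<open>'a\<close>, carried by a subspace \<open>Q\<close> of an
  ambient vector space (which may itself be infinite-dimensional).
\<close>

locale fin_dim_lie_algebra = vector_space scale
  for scale :: "'a::field \<Rightarrow> 'v::ab_group_add \<Rightarrow> 'v" +
  fixes Q :: "'v set"
    and br :: "'v \<Rightarrow> 'v \<Rightarrow> 'v"
  assumes subspace_carrier: "subspace Q"
    and finite_dimensional: "\<exists>S. finite S \<and> Q \<subseteq> span S"
    and br_closed: "\<lbrakk>x \<in> Q; y \<in> Q\<rbrakk> \<Longrightarrow> br x y \<in> Q"
    and br_add_left: "\<lbrakk>x \<in> Q; y \<in> Q; z \<in> Q\<rbrakk> \<Longrightarrow> br (x + y) z = br x z + br y z"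
    and br_add_right: "\<lbrakk>x \<in> Q; y \<in> Q; z \<in> Q\<rbrakk> \<Longrightarrow> br x (y + z) = br x y + br x z"
    and br_scale_left: "\<lbrakk>x \<in> Q; y \<in> Q\<rbrakk> \<Longrightarrow> br (scale c x) y = scale c (br x y)"
    and br_scale_right: "\<lbrakk>x \<in> Q; y \<in> Q\<rbrakk> \<Longrightarrow> br x (scale c y) = scale c (br x y)"
    and br_self: "x \<in> Q \<Longrightarrow> br x x = 0"
    and jacobi: "\<lbrakk>x \<in> Q; y \<in> Q; z \<in> Q\<rbrakk> \<Longrightarrow>
      br x (br y z) + br y (br z x) + br z (br x y) = 0"
begin

text \<open>
  Functionals on \<open>Q\<close> are functions on the ambient type that are linear on \<open>Q\<close>; their
  values outside \<open>Q\<close> are unconstrained and never used.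
\<close>

definition dual :: "('v \<Rightarrow> 'a) set" where
  "dual = {\<alpha>. (\<forall>x\<in>Q. \<forall>y\<in>Q. \<alpha> (x + y) = \<alpha> x + \<alpha> y) \<and>
              (\<forall>c. \<forall>x\<in>Q. \<alpha> (scale c x) = c * \<alpha> x)}"

definition stabiliser :: "('v \<Rightarrow> 'a) \<Rightarrow> 'v set" where
  "stabiliser \<alpha> = {\<xi> \<in> Q. \<forall>\<eta>\<in>Q. \<alpha> (br \<xi> \<eta>) = 0}"

text \<open>
  The set of dimensions is a nonempty set of natural numbers, so this infimum is a minimum.
\<close>

definition index :: nat where
  "index = (INF \<alpha>\<in>dual. dim (stabiliser \<alpha>))"

lemma zero_in_dual: "(\<lambda>_. 0) \<in> dual"
  by (simp add: dual_def)

lemma index_attained: "\<exists>\<alpha>\<in>dual. dim (stabiliser \<alpha>) = index"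
proof -
  have "index \<in> (\<lambda>\<alpha>. dim (stabiliser \<alpha>)) ` dual"
    unfolding index_def by (rule Inf_nat_def1) (use zero_in_dual in blast)
  then show ?thesis by auto
qed

end

section \<open>Endomorphisms\<close>

definition End_scale :: "('a \<Rightarrow> 'b \<Rightarrow> 'b) \<Rightarrow> 'a \<Rightarrow> ('b \<Rightarrow> 'b) \<Rightarrow> ('b \<Rightarrow> 'b)" where
  "End_scale scale c f = (\<lambda>x. scale c (f x))"

definition gl :: "('a::field \<Rightarrow> 'b::ab_group_add \<Rightarrow> 'b) \<Rightarrow> ('b \<Rightarrow> 'b) set" where
  "gl scale = {f. Vector_Spaces.linear scale scale f}"

definition commutator :: "('b \<Rightarrow> 'b) \<Rightarrow> ('b \<Rightarrow> 'b) \<Rightarrow> ('b::ab_group_add \<Rightarrow> 'b)" where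
  "commutator f g = (f \<circ> g) - (g \<circ> f)"

definition centraliser ::
    "('a::field \<Rightarrow> 'b::ab_group_add \<Rightarrow> 'b) \<Rightarrow> ('b \<Rightarrow> 'b) \<Rightarrow> ('b \<Rightarrow> 'b) set" where
  "centraliser scale e = {f \<in> gl scale. commutator e f = 0}"

definition nilpotent_map :: "('b::zero \<Rightarrow> 'b) \<Rightarrow> bool" where
  "nilpotent_map e \<longleftrightarrow> (\<exists>m. \<forall>x. (e ^^ m) x = 0)"

section \<open>Jordan blocks\<close>

definition ordered_basis :: "('a::field \<Rightarrow> 'b::ab_group_add \<Rightarrow> 'b) \<Rightarrow> 'b list \<Rightarrow> bool" where
  "ordered_basis scale bs \<longleftrightarrow>
     distinct bs \<and> \<not> module.dependent scale (set bs) \<and> module.span scale (set bs) = UNIV"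

definition represents ::
    "('a::field \<Rightarrow> 'b::ab_group_add \<Rightarrow> 'b) \<Rightarrow> 'b list \<Rightarrow> 'a mat \<Rightarrow> ('b \<Rightarrow> 'b) \<Rightarrow> bool" where
  "represents scale bs A f \<longleftrightarrow>
     A \<in> carrier_mat (length bs) (length bs) \<and>
     (\<forall>j < length bs. f (bs ! j) = (\<Sum>i < length bs. scale (A $$ (i, j)) (bs ! i)))"

text \<open>The predicate \<open>jordan_nf\<close> excludes Jordan blocks of size zero.\<close>

definition has_jordan_blocks ::
    "('a::field \<Rightarrow> 'b::ab_group_add \<Rightarrow> 'b) \<Rightarrow> ('b \<Rightarrow> 'b) \<Rightarrow> nat \<Rightarrow> bool" where
  "has_jordan_blocks scale e k \<longleftrightarrow>
     (\<exists>bs A n_as. ordered_basis scale bs \<and> represents scale bs A e \<and>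
        jordan_nf A n_as \<and> length n_as = k)"

section \<open>The centraliser is a Lie algebra\<close>

lemma vector_space_End_scale:
  assumes "vector_space scale"
  shows "vector_space (End_scale scale)"
proof -
  interpret vector_space scale by fact
  show ?thesis
    by unfold_locales
      (auto simp: End_scale_def fun_eq_iff scale_right_distrib scale_left_distrib)
qed

lemma fin_dim_lie_algebra_centraliser:
  fixes scale :: "'a::field \<Rightarrow> 'b::ab_group_add \<Rightarrow> 'b"
  assumes "finite_dimensional_vector_space scale Basis"
    and "e \<in> gl scale"
  shows "fin_dim_lie_algebra (End_scale scale) (centraliser scale e) commutator"
proof -
  interpret V: finite_dimensional_vector_space scale Basis by fact
  interpret E: vector_space "End_scale scale"
    by (rule vector_space_End_scale) unfold_locales
  interpret P: vector_space_pair scale scale by unfold_locales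
  have lin: "f \<in> gl scale \<longleftrightarrow>
      (\<forall>x y. f (x + y) = f x + f y) \<and> (\<forall>c x. f (scale c x) = scale c (f x))" for f
    unfolding gl_def mem_Collect_eq Vector_Spaces.linear_iff using V.vector_space_axioms by blast
  have mem: "f \<in> centraliser scale e \<longleftrightarrow> f \<in> gl scale \<and> (\<forall>x. e (f x) = f (e x))" for f
    by (auto simp: centraliser_def commutator_def fun_eq_iff)
  have sub: "E.subspace (centraliser scale e)"
  proof (rule E.subspaceI)
    note e = assms(2)
    have z: "e 0 = 0"
      using e lin by (metis V.scale_zero_left)
    show "0 \<in> centraliser scale e"
      by (auto simp: mem lin z)
    show "f + g \<in> centraliser scale e"
      if "f \<in> centraliser scale e" "g \<in> centraliser scale e" for f g
      using that e by (auto simp: mem lin V.scale_right_distrib algebra_simps)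
    show "End_scale scale c f \<in> centraliser scale e" if "f \<in> centraliser scale e" for c f
      using that e by (auto simp: mem lin End_scale_def V.scale_right_distrib mult.commute)
  qed
  let ?elem = "\<lambda>(b, c) x. scale (V.representation Basis x b) c"
  have fin: "f \<in> E.span (?elem ` (Basis \<times> Basis))" if "f \<in> gl scale" for f
  proof -
    have hom: "module_hom scale scale f"
      using that by (simp add: gl_def Vector_Spaces.linear_iff_module_hom)
    have expand: "(\<Sum>b\<in>Basis. scale (V.representation Basis x b) b) = x" for x
      using V.sum_representation_eq[of Basis x Basis] V.independent_Basis V.finite_Basis
        V.span_Basis by auto
    have "f = (\<Sum>(b, c) \<in> Basis \<times> Basis.
      End_scale scale (V.representation Basis (f b) c) (?elem (b, c)))"
    proof
      fix x
      have app: "(\<Sum>p\<in>S. F p) x = (\<Sum>p\<in>S. F p x)" for F :: "'b \<times> 'b \<Rightarrow> 'b \<Rightarrow> 'b" and S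
        by (induction S rule: infinite_finite_induct) auto
      have "f x = f (\<Sum>b\<in>Basis. scale (V.representation Basis x b) b)"
        by (simp add: expand)
      also have "\<dots> = (\<Sum>b\<in>Basis. scale (V.representation Basis x b) (f b))"
        by (simp add: module_hom.sum[OF hom] module_hom.scale[OF hom])
      also have "\<dots> = (\<Sum>b\<in>Basis. scale (V.representation Basis x b)
          (\<Sum>c\<in>Basis. scale (V.representation Basis (f b) c) c))"
        by (simp add: expand)
      also have "\<dots> = (\<Sum>(b, c) \<in> Basis \<times> Basis.
          scale (V.representation Basis (f b) c) (scale (V.representation Basis x b) c))"
        by (simp add: V.scale_sum_right sum.cartesian_product mult.commute)
      also have "\<dots> = (\<Sum>(b, c) \<in> Basis \<times> Basis.
          End_scale scale (V.representation Basis (f b) c) (?elem (b, c))) x"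
        unfolding app by (rule sum.cong) (auto simp: End_scale_def)
      finally show "f x = \<dots>" .
    qed
    also have "\<dots> \<in> E.span (?elem ` (Basis \<times> Basis))"
    proof (rule E.span_sum)
      fix p assume "p \<in> Basis \<times> Basis"
      then have "?elem p \<in> E.span (?elem ` (Basis \<times> Basis))"
        by (intro E.span_base imageI)
      then show "(case p of (b, c) \<Rightarrow>
          End_scale scale (V.representation Basis (f b) c) (?elem (b, c)))
          \<in> E.span (?elem ` (Basis \<times> Basis))"
        by (cases p) (auto intro: E.span_scale)
    qed
    finally show ?thesis .
  qed
  have diff: "f (x - y) = f x - f y" if "f \<in> gl scale" for f x y
    using that unfolding lin by (metis add_diff_cancel_right' diff_add_cancel)
  have comp: "commutator f g x = f (g x) - g (f x)" for f g :: "'b \<Rightarrow> 'b" and x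
    by (simp add: commutator_def)
  have inD: "f \<in> gl scale" if "f \<in> centraliser scale e" for f
    using that by (simp add: mem)
  have linD: "f (x + y) = f x + f y" "f (scale c x) = scale c (f x)"
    if "f \<in> centraliser scale e" for f x y c
    using that by (auto simp: mem lin)
  show ?thesis
  proof
    show "E.subspace (centraliser scale e)"
      by (rule sub)
    show "\<exists>S. finite S \<and> centraliser scale e \<subseteq> E.span S"
      using fin inD V.finite_Basis by (intro exI[of _ "?elem ` (Basis \<times> Basis)"]) auto
    show "commutator f g \<in> centraliser scale e"
      if "f \<in> centraliser scale e" "g \<in> centraliser scale e" for f g
      using that assms(2) diff[of e]
      by (auto simp: mem lin comp V.scale_right_diff_distrib)
  next
    fix f g h :: "'b \<Rightarrow> 'b" and c
    assume f: "f \<in> centraliser scale e" and g: "g \<in> centraliser scale e"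
    show "commutator (End_scale scale c f) g = End_scale scale c (commutator f g)"
      "commutator f (End_scale scale c g) = End_scale scale c (commutator f g)"
      using f g
      by (auto simp: fun_eq_iff comp End_scale_def linD V.scale_right_diff_distrib)
    assume h: "h \<in> centraliser scale e"
    show "commutator (f + g) h = commutator f h + commutator g h"
      "commutator f (g + h) = commutator f g + commutator f h"
      using f g h by (auto simp: fun_eq_iff comp linD)
    show "commutator f (commutator g h) + commutator g (commutator h f) +
        commutator h (commutator f g) = 0"
      using f g h inD by (auto simp: fun_eq_iff comp diff)
  qed (auto simp: fun_eq_iff comp)
qed

end

theory Submission
  imports Defs
begin

text \<open>
  The index is bounded from both sides. Let \<open>w\<^sub>1, \<dots>, w\<^sub>k\<close> generate the Jordan blocks of \<open>e\<close>. An
  element of the centraliser is given by the images of these generators.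

  For the upper bound, a functional \<open>\<alpha>\<close> is exhibited whose stabiliser has dimension at most \<open>n\<close>:
  the weighted sum, over all blocks, of the coefficient of the last vector of the block in the
  image of its generator. Let the weights be pairwise distinct, and let a zero weight occur only at
  a block of minimal size; \<open>k\<close> scalars are enough for this. Evaluating \<open>\<alpha>\<close> on the commutators with
  maps between two blocks shows that a stabilising endomorphism maps every block to itself
  (\<open>stabiliser_block_diagonal\<close>). It is then a combination of the powers of \<open>e\<close> on the single blocks,
  of which there are \<open>n\<close> (\<open>stabiliser_span\<close>).

  For the lower bound, every functional \<open>\<alpha>\<close> on the centraliser is the restriction of
  \<open>f \<mapsto> trace (y \<circ> f)\<close> for some endomorphism \<open>y\<close>. Following Vinberg, \<open>e\<close> is deformed in the direction
  of \<open>y\<close>: if a polynomial \<open>P = P\<^sub>0 + t P\<^sub>1 + \<dots>\<close> with coefficients in \<open>gl(V)\<close> commutes with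
  \<open>x = e + t y + t\<^sup>2 z\<close>, then the coefficients of \<open>1\<close> and \<open>t\<close> say that \<open>P\<^sub>0\<close> centralises \<open>e\<close> and
  stabilises \<open>\<alpha>\<close> (\<open>constant_term_stabilises\<close>). It remains to find an \<open>n\<close>-dimensional space of such
  constant terms. With a cyclic shift for \<open>z\<close> the powers \<open>1, x, \<dots>, x\<^sup>n\<^sup>-\<^sup>1\<close> are independent over
  the polynomials in \<open>t\<close>, so the space of commuting polynomials of bounded degree grows with the
  degree at least at the rate \<open>n\<close>. It grows at most at the rate of the dimension of the space of
  constant terms, because a commuting polynomial without constant term is divisible by \<open>t\<close>
  (\<open>many_constant_terms\<close>). The count takes place over the given field, so no extension of a finite
  field is involved.
\<close>

section \<open>Bases, coordinates and the trace form\<close>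

lemma sum_fun_apply: "(\<Sum>i\<in>S. F i) x = (\<Sum>i\<in>S. F i x)"
  for F :: "'i \<Rightarrow> 'x \<Rightarrow> 'y::comm_monoid_add"
  by (induction S rule: infinite_finite_induct) auto

lemma (in vector_space) extend_functional:
  assumes Q: "subspace Q"
    and add: "\<And>x y. \<lbrakk>x \<in> Q; y \<in> Q\<rbrakk> \<Longrightarrow> f (x + y) = f x + f y"
    and hom: "\<And>r x. x \<in> Q \<Longrightarrow> f (scale r x) = r * f x"
  obtains g where "\<And>x y. g (x + y) = g x + g y" "\<And>r x. g (scale r x) = r * g x"
    "\<And>x. x \<in> Q \<Longrightarrow> g x = f x"
proof -
  have "vector_space ((*) :: 'a \<Rightarrow> 'a \<Rightarrow> 'a)"
    by unfold_locales (auto simp: algebra_simps)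
  then have pair: "vector_space_pair scale ((*) :: 'a \<Rightarrow> 'a \<Rightarrow> 'a)"
    by (rule vector_space_pair.intro[OF vector_space_axioms])
  obtain B where B: "B \<subseteq> Q" "independent B" "Q \<subseteq> span B"
    by (rule basis_exists)
  obtain g where lin: "Vector_Spaces.linear scale (*) g" and gB: "\<And>x. x \<in> B \<Longrightarrow> g x = f x"
    using vector_space_pair.linear_independent_extend[OF pair B(2), of f] by blast
  have g: "g (x + y) = g x + g y" "g (scale r x) = r * g x" for x y r
    using lin by (auto simp: Vector_Spaces.linear_iff)
  have g0: "g 0 = 0"
    using g(2)[of 0 0] by simp
  have f0: "f 0 = 0"
    using hom[of 0 0] subspace_0[OF Q] by simp
  have "x \<in> Q \<and> g x = f x" if "x \<in> span B" for x
    using that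
  proof (induction rule: span_induct_alt)
    case base
    then show ?case by (simp add: f0 g0 subspace_0[OF Q])
  next
    case (step r b y)
    moreover have "b \<in> Q" using step B(1) by blast
    moreover have "scale r b \<in> Q" using \<open>b \<in> Q\<close> Q by (rule subspace_scale[rotated])
    ultimately show ?case
      using Q by (auto simp: g gB add hom intro: subspace_add)
  qed
  then show ?thesis
    using that[of g] g B(3) by blast
qed

text \<open>
  Independence is asked of the indexed family, so that the conclusion counts indices; injectivity of
  the family is part of what is derived.
\<close>

lemma (in vector_space) card_le_of_independent_family:
  assumes "finite A" "finite S"
    and F: "F ` A \<subseteq> span S"
    and indep: "\<And>q a. \<lbrakk>(\<Sum>a\<in>A. scale (q a) (F a)) = 0; a \<in> A\<rbrakk> \<Longrightarrow> q a = 0"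
  shows "card A \<le> card S"
proof -
  have inj: "inj_on F A"
  proof (rule inj_onI, rule ccontr)
    fix a b assume ab: "a \<in> A" "b \<in> A" "F a = F b" "a \<noteq> b"
    define q where "q x = (if x = a then 1 else if x = b then -1 else 0 :: 'a)" for x
    have "(\<Sum>x\<in>A. scale (q x) (F x)) = (\<Sum>x\<in>{a,b}. scale (q x) (F x))"
      using ab \<open>finite A\<close> by (intro sum.mono_neutral_right) (auto simp: q_def)
    also have "\<dots> = 0"
      using ab by (simp add: q_def)
    finally have "q a = 0" using indep ab by blast
    then show False by (simp add: q_def)
  qed
  have "independent (F ` A)"
  proof (rule independent_if_scalars_zero)
    fix f x assume 0: "(\<Sum>x\<in>F ` A. scale (f x) x) = 0" and x: "x \<in> F ` A"
    have "(\<Sum>a\<in>A. scale (f (F a)) (F a)) = 0"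
      using 0 by (simp add: sum.reindex[OF inj])
    then show "f x = 0" using indep[of "f \<circ> F"] x by auto
  qed (use \<open>finite A\<close> in simp)
  then have "card (F ` A) \<le> card S"
    using independent_span_bound[OF \<open>finite S\<close>] F by blast
  then show ?thesis by (simp add: card_image[OF inj])
qed

text \<open>
  A finite basis \<open>u\<close> together with its dual family \<open>c\<close> of coordinate functions. Working with the
  pair makes every later argument a computation with coordinates, and the arbitrary index set lets
  the same space carry both a Jordan basis, indexed by pairs, and a basis numbered by
  \<open>0, \<dots>, n - 1\<close>.
\<close>

locale dual_basis = vector_space scale
  for scale :: "'a::field \<Rightarrow> 'b::ab_group_add \<Rightarrow> 'b" +
  fixes I :: "'i set" and u :: "'i \<Rightarrow> 'b" and c :: "'i \<Rightarrow> 'b \<Rightarrow> 'a"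
  assumes finite_I: "finite I"
    and coord_add: "i \<in> I \<Longrightarrow> c i (x + y) = c i x + c i y"
    and coord_scale: "i \<in> I \<Longrightarrow> c i (scale r x) = r * c i x"
    and coord_basis: "\<lbrakk>i \<in> I; j \<in> I\<rbrakk> \<Longrightarrow> c i (u j) = (if i = j then 1 else 0)"
    and expansion: "(\<Sum>i\<in>I. scale (c i x) (u i)) = x"
begin

lemma gl_iff:
  "f \<in> gl scale \<longleftrightarrow> (\<forall>x y. f (x + y) = f x + f y) \<and> (\<forall>r x. f (scale r x) = scale r (f x))"
  unfolding gl_def mem_Collect_eq Vector_Spaces.linear_iff using vector_space_axioms by blast

lemma gl_add: "f \<in> gl scale \<Longrightarrow> f (x + y) = f x + f y"
  and gl_scale: "f \<in> gl scale \<Longrightarrow> f (scale r x) = scale r (f x)"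
  by (auto simp: gl_iff)

lemma gl_zero: "f \<in> gl scale \<Longrightarrow> f 0 = 0"
  using gl_scale[of f 0 0] by simp

lemma gl_diff: "f \<in> gl scale \<Longrightarrow> f (x - y) = f x - f y"
  by (metis gl_add add_diff_cancel diff_add_cancel)

lemma gl_sum: "f \<in> gl scale \<Longrightarrow> f (\<Sum>i\<in>S. g i) = (\<Sum>i\<in>S. f (g i))"
  by (induction S rule: infinite_finite_induct) (auto simp: gl_add gl_zero)

lemma gl_comp: "\<lbrakk>f \<in> gl scale; g \<in> gl scale\<rbrakk> \<Longrightarrow> f \<circ> g \<in> gl scale"
  by (simp add: gl_iff)

lemma gl_plus: "\<lbrakk>f \<in> gl scale; g \<in> gl scale\<rbrakk> \<Longrightarrow> f + g \<in> gl scale"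
  by (simp add: gl_iff scale_right_distrib algebra_simps)

lemma gl_End_scale: "f \<in> gl scale \<Longrightarrow> End_scale scale r f \<in> gl scale"
  by (simp add: gl_iff End_scale_def scale_right_distrib mult.commute)

lemma zero_in_gl: "0 \<in> gl scale"
  by (simp add: gl_iff)

lemma coord_zero: "i \<in> I \<Longrightarrow> c i 0 = 0"
  using coord_scale[of i 0 0] by simp

lemma coord_diff: "i \<in> I \<Longrightarrow> c i (x - y) = c i x - c i y"
  by (metis coord_add add_diff_cancel diff_add_cancel)

lemma coord_sum: "i \<in> I \<Longrightarrow> c i (\<Sum>j\<in>S. g j) = (\<Sum>j\<in>S. c i (g j))"
  by (induction S rule: infinite_finite_induct) (auto simp: coord_add coord_zero)

lemma linear_combination_in_gl:
  assumes "J \<subseteq> I"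
  shows "(\<lambda>x. \<Sum>i\<in>J. scale (c i x) (w i)) \<in> gl scale"
proof -
  have J: "i \<in> I" if "i \<in> J" for i
    using that assms by blast
  show ?thesis
    by (simp add: gl_iff J coord_add coord_scale scale_left_distrib sum.distrib scale_sum_right
        cong: sum.cong)
qed

lemma gl_eqI:
  assumes "f \<in> gl scale" "g \<in> gl scale" and "\<And>i. i \<in> I \<Longrightarrow> f (u i) = g (u i)"
  shows "f = g"
proof
  fix x
  have "f (\<Sum>i\<in>I. scale (c i x) (u i)) = g (\<Sum>i\<in>I. scale (c i x) (u i))"
    using assms by (simp add: gl_sum gl_scale)
  then show "f x = g x" by (simp add: expansion)
qed

lemma coord_gl:
  assumes "f \<in> gl scale" "i \<in> I"
  shows "c i (f x) = (\<Sum>j\<in>I. c j x * c i (f (u j)))"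
proof -
  have "c i (f x) = c i (f (\<Sum>j\<in>I. scale (c j x) (u j)))"
    by (simp add: expansion)
  then show ?thesis
    using assms by (simp add: gl_sum gl_scale coord_sum coord_scale)
qed

lemma basis_inj: "inj_on u I"
  by (rule inj_onI) (metis coord_basis zero_neq_one)

lemma dim_space: "dim UNIV = card I"
proof -
  have "independent (u ` I)"
  proof (rule independent_if_scalars_zero)
    fix f x assume 0: "(\<Sum>x\<in>u ` I. scale (f x) x) = 0" and "x \<in> u ` I"
    then obtain i where i: "i \<in> I" "x = u i" by blast
    have "0 = c i (\<Sum>j\<in>I. scale (f (u j)) (u j))"
      using 0 i by (simp add: sum.reindex[OF basis_inj] coord_zero)
    also have "\<dots> = (\<Sum>j\<in>I. f (u j) * (if i = j then 1 else 0))"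
      using i by (simp add: coord_sum coord_scale coord_basis cong: sum.cong)
    also have "\<dots> = f x"
      using i finite_I by (simp add: if_distrib cong: if_cong)
    finally show "f x = 0" by simp
  qed (use finite_I in simp)
  moreover have "UNIV \<subseteq> span (u ` I)"
  proof
    fix x
    have "(\<Sum>i\<in>I. scale (c i x) (u i)) \<in> span (u ` I)"
      by (intro span_sum span_scale span_base imageI)
    then show "x \<in> span (u ` I)" by (simp only: expansion)
  qed
  ultimately have "card (u ` I) = dim UNIV"
    by (intro basis_card_eq_dim) auto
  then show ?thesis
    by (simp add: card_image[OF basis_inj])
qed

lemma reindex:
  assumes "bij_betw g J I"
  shows "dual_basis scale J (u \<circ> g) (c \<circ> g)"
proof
  have gI: "g j \<in> I" if "j \<in> J" for j
    using assms that by (auto simp: bij_betw_def)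
  show "finite J"
    using assms finite_I bij_betw_finite by blast
  show "(c \<circ> g) i (x + y) = (c \<circ> g) i x + (c \<circ> g) i y"
    "(c \<circ> g) i (scale r x) = r * (c \<circ> g) i x" if "i \<in> J" for i x y r
    using gI[OF that] by (simp_all add: coord_add coord_scale)
  show "(c \<circ> g) i ((u \<circ> g) j) = (if i = j then 1 else 0)" if "i \<in> J" "j \<in> J" for i j
    using that gI assms by (auto simp: coord_basis bij_betw_def inj_on_def)
  show "(\<Sum>i\<in>J. scale ((c \<circ> g) i x) ((u \<circ> g) i)) = x" for x
    using sum.reindex_bij_betw[OF assms, of "\<lambda>i. scale (c i x) (u i)"] by (simp add: expansion)
qed

definition trace :: "('b \<Rightarrow> 'b) \<Rightarrow> 'a" where
  "trace f = (\<Sum>i\<in>I. c i (f (u i)))"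

lemma trace_comm:
  assumes "f \<in> gl scale" "g \<in> gl scale"
  shows "trace (f \<circ> g) = trace (g \<circ> f)"
proof -
  have "trace (f \<circ> g) = (\<Sum>i\<in>I. \<Sum>j\<in>I. c j (g (u i)) * c i (f (u j)))"
    using assms by (simp add: trace_def coord_gl[of f] cong: sum.cong)
  also have "\<dots> = (\<Sum>j\<in>I. \<Sum>i\<in>I. c i (f (u j)) * c j (g (u i)))"
    by (subst sum.swap) (simp add: mult.commute)
  also have "\<dots> = trace (g \<circ> f)"
    using assms by (simp add: trace_def coord_gl[of g] cong: sum.cong)
  finally show ?thesis .
qed

lemma trace_add: "trace (f + g) = trace f + trace g"
  by (simp add: trace_def coord_add sum.distrib cong: sum.cong)

lemma trace_diff: "trace (f - g) = trace f - trace g"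
  by (simp add: trace_def coord_diff sum_subtractf cong: sum.cong)

text \<open>
  The trace form on \<open>gl(V)\<close> is nondegenerate. The entries of \<open>y\<close> are the values of \<open>\<alpha>\<close> on the
  matrix units \<open>E i j\<close>, which send \<open>u i\<close> to \<open>u j\<close>.
\<close>

lemma functional_is_trace:
  assumes add: "\<And>f g. \<alpha> (f + g) = \<alpha> f + \<alpha> g"
    and hom: "\<And>r f. \<alpha> (End_scale scale r f) = r * \<alpha> f"
  obtains y where "y \<in> gl scale" "\<And>f. f \<in> gl scale \<Longrightarrow> \<alpha> f = trace (y \<circ> f)"
proof -
  define E where "E i j = (\<lambda>x. scale (c i x) (u j))" for i j
  define y where "y = (\<lambda>x. \<Sum>j\<in>I. scale (c j x) (\<Sum>i\<in>I. scale (\<alpha> (E i j)) (u i)))"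
  have a0: "\<alpha> 0 = 0"
  proof -
    have "End_scale scale 0 0 = 0"
      by (simp add: End_scale_def fun_eq_iff)
    then show ?thesis using hom[of 0 0] by simp
  qed
  have asum: "\<alpha> (\<Sum>i\<in>S. F i) = (\<Sum>i\<in>S. \<alpha> (F i))" for F and S :: "'i set"
    by (induction S rule: infinite_finite_induct)
      (simp_all only: sum.infinite sum.empty sum.insert not_False_eq_True add a0)
  have y: "y \<in> gl scale"
    unfolding y_def by (rule linear_combination_in_gl) simp
  have "\<alpha> f = trace (y \<circ> f)" if f: "f \<in> gl scale" for f
  proof -
    have f_eq: "f = (\<Sum>i\<in>I. \<Sum>j\<in>I. End_scale scale (c j (f (u i))) (E i j))"
    proof (rule ext)
      fix x
      have "f x = f (\<Sum>i\<in>I. scale (c i x) (u i))" by (simp add: expansion)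
      also have "\<dots> = (\<Sum>i\<in>I. scale (c i x) (f (u i)))"
        by (simp only: gl_sum[OF f] gl_scale[OF f])
      also have "\<dots> = (\<Sum>i\<in>I. scale (c i x) (\<Sum>j\<in>I. scale (c j (f (u i))) (u j)))"
        by (simp only: expansion)
      finally show "f x = (\<Sum>i\<in>I. \<Sum>j\<in>I. End_scale scale (c j (f (u i))) (E i j)) x"
        by (simp add: sum_fun_apply End_scale_def E_def scale_sum_right mult.commute)
    qed
    have "\<alpha> f = (\<Sum>i\<in>I. \<Sum>j\<in>I. c j (f (u i)) * \<alpha> (E i j))"
      using arg_cong[OF f_eq, of \<alpha>] by (simp only: asum hom)
    also have "\<dots> = (\<Sum>i\<in>I. c i (y (f (u i))))"
    proof (rule sum.cong[OF refl])
      fix i assume i: "i \<in> I"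
      have "c i (y x) = (\<Sum>j\<in>I. c j x * \<alpha> (E i j))" for x
      proof -
        have "c i (\<Sum>l\<in>I. scale (\<alpha> (E l j)) (u l)) = \<alpha> (E i j)" for j
        proof -
          have "c i (\<Sum>l\<in>I. scale (\<alpha> (E l j)) (u l))
              = (\<Sum>l\<in>I. \<alpha> (E l j) * (if i = l then 1 else 0))"
            using i by (simp add: coord_sum coord_scale coord_basis cong: sum.cong)
          then show ?thesis using i finite_I by (simp add: if_distrib cong: if_cong)
        qed
        then show ?thesis
          using i by (simp add: y_def coord_sum coord_scale)
      qed
      then show "(\<Sum>j\<in>I. c j (f (u i)) * \<alpha> (E i j)) = c i (y (f (u i)))" by simp
    qed
    finally show ?thesis by (simp add: trace_def)
  qed
  with y that show ?thesis by blast
qed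

end

section \<open>Stabilisers of weighted diagonal functionals\<close>

text \<open>
  Here \<open>u i s\<close> is \<open>e ^ s\<close> applied to the generator \<open>u i 0\<close> of the \<open>i\<close>-th Jordan block, of size \<open>m i\<close>.
  Putting \<open>u i s = 0\<close> beyond the block makes \<open>e (u i s) = u i (Suc s)\<close> hold for all \<open>s\<close>.
\<close>

locale jordan_basis = dual_basis scale "SIGMA i:{..<k}. {..<m i}" "\<lambda>(i, s). u i s" c
  for scale :: "'a::field \<Rightarrow> 'b::ab_group_add \<Rightarrow> 'b" and k :: nat and m :: "nat \<Rightarrow> nat"
    and u :: "nat \<Rightarrow> nat \<Rightarrow> 'b" and c +
  fixes e :: "'b \<Rightarrow> 'b"
  assumes e: "e \<in> gl scale"
    and e_u: "\<lbrakk>i < k; s < m i\<rbrakk> \<Longrightarrow> e (u i s) = u i (Suc s)"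
    and u_beyond: "\<lbrakk>i < k; m i \<le> s\<rbrakk> \<Longrightarrow> u i s = 0"
    and m_pos: "i < k \<Longrightarrow> 0 < m i"
begin

abbreviation Z where "Z \<equiv> centraliser scale e"

sublocale E: vector_space "End_scale scale"
  by (rule vector_space_End_scale) (rule vector_space_axioms)

lemma Z_iff: "f \<in> Z \<longleftrightarrow> f \<in> gl scale \<and> (\<forall>x. e (f x) = f (e x))"
  by (auto simp: centraliser_def commutator_def fun_eq_iff)

lemma coord_u:
  assumes "i < k" "s < m i" "j < k"
  shows "c (i, s) (u j t) = (if i = j \<and> s = t then 1 else 0)"
proof (cases "t < m j")
  case True
  then show ?thesis
    using coord_basis[of "(i, s)" "(j, t)"] assms by simp
next
  case False
  then show ?thesis
    using assms coord_zero[of "(i, s)"] by (auto simp: u_beyond)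
qed

lemma e_u': "i < k \<Longrightarrow> e (u i s) = u i (Suc s)"
  by (cases "s < m i") (simp_all add: e_u u_beyond gl_zero[OF e])

lemma expansion': "(\<Sum>i<k. \<Sum>s<m i. scale (c (i, s) x) (u i s)) = x"
  using expansion[of x] by (simp add: sum.Sigma case_prod_unfold)

text \<open>
  An endomorphism \<open>f\<close> commuting with \<open>e\<close> is determined by the images of the generators, as
  \<open>f (u i t) = e ^ t (f (u i 0))\<close>.
\<close>

lemma Z_u:
  assumes f: "f \<in> Z" and i: "i < k" and j: "j < k" "s < m j"
  shows "c (j, s) (f (u i t)) = (if t \<le> s then c (j, s - t) (f (u i 0)) else 0)"
  using j(2)
proof (induction t arbitrary: s)
  case 0
  then show ?case by simp
next
  case (Suc t)
  have ce: "c (j, s) (e x) = (if s = 0 then 0 else c (j, s - 1) x)" for x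
  proof -
    have "c (j, s) (e x)
        = (\<Sum>p\<in>(SIGMA i:{..<k}. {..<m i}). c p x * c (j, s) (e (case p of (i, s) \<Rightarrow> u i s)))"
      by (rule coord_gl) (use e j Suc.prems in auto)
    also have "\<dots> = (\<Sum>p\<in>(SIGMA i:{..<k}. {..<m i}). if s \<noteq> 0 \<and> p = (j, s - 1) then c p x else 0)"
      using j(1) Suc.prems by (intro sum.cong) (auto simp: e_u' coord_u split: if_splits)
    also have "\<dots> = (if s = 0 then 0 else c (j, s - 1) x)"
      using finite_I j(1) Suc.prems by auto
    finally show ?thesis .
  qed
  have "f (u i (Suc t)) = e (f (u i t))"
    using f i by (simp add: Z_iff e_u'[symmetric])
  then have "c (j, s) (f (u i (Suc t))) = (if s = 0 then 0 else c (j, s - 1) (f (u i t)))"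
    by (simp add: ce)
  also have "\<dots> = (if Suc t \<le> s then c (j, s - Suc t) (f (u i 0)) else 0)"
    using Suc.IH[of "s - 1"] Suc.prems by (cases s) auto
  finally show ?case .
qed

text \<open>
  The relation \<open>e ^ m i (u i 0) = 0\<close> is inherited by \<open>f (u i 0)\<close>, so in a longer block \<open>j\<close> only the
  last \<open>m i\<close> coordinates can be nonzero.
\<close>

lemma Z_vanish:
  assumes f: "f \<in> Z" and "i < k" "j < k" "s + m i < m j"
  shows "c (j, s) (f (u i 0)) = 0"
  using Z_u[OF f \<open>i < k\<close> \<open>j < k\<close>, of "s + m i" "m i"] assms
  by (simp add: Z_iff u_beyond gl_zero coord_zero)

text \<open>
  The standard basis of the centraliser: the map that sends the generator of block \<open>j\<close> to \<open>u i t\<close> and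
  the generators of all other blocks to \<open>0\<close>. It commutes with \<open>e\<close> precisely when \<open>e ^ m j\<close> annihilates
  \<open>u i t\<close>, that is, \<open>m i \<le> m j + t\<close>.
\<close>

definition block_map :: "nat \<Rightarrow> nat \<Rightarrow> nat \<Rightarrow> 'b \<Rightarrow> 'b" where
  "block_map j i t = (\<lambda>x. \<Sum>s<m j. scale (c (j, s) x) (u i (s + t)))"

lemma block_map_gl: "j < k \<Longrightarrow> block_map j i t \<in> gl scale"
proof -
  assume j: "j < k"
  have "block_map j i t = (\<lambda>x. \<Sum>p\<in>{j}\<times>{..<m j}. scale (c p x) (u i (snd p + t)))"
    unfolding block_map_def sum.cartesian_product' by (simp add: case_prod_unfold)
  then show ?thesis
    using linear_combination_in_gl[of "{j}\<times>{..<m j}" "\<lambda>p. u i (snd p + t)"] j by auto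
qed

lemma block_map_u:
  assumes "j < k" "i < k" "l < k" "m i \<le> m j + t"
  shows "block_map j i t (u l s) = (if l = j then u i (s + t) else 0)"
proof -
  have "block_map j i t (u l s) = (\<Sum>r<m j. if r = s \<and> l = j then u i (s + t) else 0)"
    unfolding block_map_def using assms by (intro sum.cong) (auto simp: coord_u)
  also have "\<dots> = (if l = j then u i (s + t) else 0)"
    using assms by (auto simp: u_beyond)
  finally show ?thesis .
qed

lemma block_map_Z:
  assumes "j < k" "i < k" "m i \<le> m j + t"
  shows "block_map j i t \<in> Z"
proof -
  have "e \<circ> block_map j i t = block_map j i t \<circ> e"
  proof (rule gl_eqI)
    show "e \<circ> block_map j i t \<in> gl scale" "block_map j i t \<circ> e \<in> gl scale"
      using assms by (simp_all add: gl_comp e block_map_gl)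
    show "(e \<circ> block_map j i t) (case p of (i, s) \<Rightarrow> u i s) = (block_map j i t \<circ> e) (case p of (i, s) \<Rightarrow> u i s)"
      if "p \<in> (SIGMA i:{..<k}. {..<m i})" for p
      using that assms by (auto simp: e_u' block_map_u gl_zero[OF e])
  qed
  then show ?thesis
    using assms by (auto simp: Z_iff block_map_gl fun_eq_iff)
qed

lemma coord_block_map:
  assumes "j < k" "i < k" "l < k" "r < m l" "t \<le> r" "r < m j + t"
  shows "c (l, r) (block_map j i t x) = (if l = i then c (j, r - t) x else 0)"
proof -
  have "c (l, r) (block_map j i t x) = (\<Sum>s<m j. c (j, s) x * c (l, r) (u i (s + t)))"
    unfolding block_map_def using assms by (simp add: coord_sum coord_scale)
  also have "\<dots> = (\<Sum>s<m j. if s = r - t \<and> l = i then c (j, s) x else 0)"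
    using assms by (intro sum.cong) (auto simp: coord_u)
  also have "\<dots> = (if l = i then c (j, r - t) x else 0)"
    using assms by auto
  finally show ?thesis .
qed

text \<open>
  The last coefficient is used because the pairing of polynomials modulo \<open>t ^ m\<close> given by the
  coefficient of \<open>t ^ (m - 1)\<close> in the product is nondegenerate: by varying the second factor of a
  commutator, every coefficient of the first one becomes visible.
\<close>

definition diag_form :: "(nat \<Rightarrow> 'a) \<Rightarrow> ('b \<Rightarrow> 'b) \<Rightarrow> 'a" where
  "diag_form a f = (\<Sum>i<k. a i * c (i, m i - 1) (f (u i 0)))"

lemma diag_form_add: "diag_form a (f + g) = diag_form a f + diag_form a g"
  unfolding diag_form_def sum.distrib[symmetric]
  by (intro sum.cong) (auto simp: coord_add m_pos algebra_simps)

lemma diag_form_scale: "diag_form a (End_scale scale r f) = r * diag_form a f"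
  unfolding diag_form_def sum_distrib_left
  by (intro sum.cong) (auto simp: coord_scale m_pos End_scale_def)

lemma diag_form_commutator:
  assumes f: "f \<in> Z" and i: "i < k" and j: "j < k" and t: "m i \<le> m j + t" "t < m i"
  shows "diag_form a (commutator f (block_map j i t)) =
    a j * (if t < m j then c (j, m j - 1 - t) (f (u i 0)) else 0) - a i * c (j, m i - 1 - t) (f (u i 0))"
proof -
  have idx: "m l - 1 < m l" if "l < k" for l
    using m_pos[OF that] by simp
  have 1: "c (l, m l - 1) (f (block_map j i t (u l 0)))
      = (if l = j then (if t < m j then c (j, m j - 1 - t) (f (u i 0)) else 0) else 0)" if l: "l < k" for l
  proof -
    have "f 0 = 0" using f by (simp add: Z_iff gl_zero)
    then show ?thesis
      using Z_u[OF f i j idx[OF j], of t] l i j t m_pos[OF j]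
      by (auto simp: block_map_u coord_zero m_pos)
  qed
  have 2: "c (l, m l - 1) (block_map j i t (f (u l 0)))
      = (if l = i then c (j, m i - 1 - t) (f (u i 0)) else 0)" if l: "l < k" for l
  proof (cases "l = i")
    case True
    then show ?thesis using coord_block_map[OF j i i idx[OF i], of t] t m_pos[OF i] by simp
  next
    case False
    have "c (l, m l - 1) (block_map j i t x) = 0" for x
      unfolding block_map_def using idx[OF l] l i False by (simp add: coord_sum coord_scale coord_u)
    then show ?thesis using False by simp
  qed
  have "diag_form a (commutator f (block_map j i t)) =
      (\<Sum>l<k. (if l = j then a j * (if t < m j then c (j, m j - 1 - t) (f (u i 0)) else 0) else 0)
        - (if l = i then a i * c (j, m i - 1 - t) (f (u i 0)) else 0))"
    unfolding diag_form_def
  proof (rule sum.cong[OF refl])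
    fix l assume "l \<in> {..<k}"
    then have l: "l < k" by simp
    have "c (l, m l - 1) (commutator f (block_map j i t) (u l 0))
        = c (l, m l - 1) (f (block_map j i t (u l 0))) - c (l, m l - 1) (block_map j i t (f (u l 0)))"
      using l m_pos[OF l] by (simp add: commutator_def coord_diff)
    then show "a l * c (l, m l - 1) (commutator f (block_map j i t) (u l 0))
        = (if l = j then a j * (if t < m j then c (j, m j - 1 - t) (f (u i 0)) else 0) else 0)
          - (if l = i then a i * c (j, m i - 1 - t) (f (u i 0)) else 0)"
      by (simp only: 1[OF l] 2[OF l] right_diff_distrib) simp
  qed
  then show ?thesis
    using i j by (simp add: sum_subtractf)
qed

text \<open>
  For \<open>f\<close> in the stabiliser write \<open>\<gamma> s\<close> for the coefficient of \<open>u j s\<close> in \<open>f (u i 0)\<close>. The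
  commutators with the maps from block \<open>j\<close> to block \<open>i\<close> give
  \<open>a j \<gamma> (m j - 1 - t) = a i \<gamma> (m i - 1 - t)\<close>. If the blocks have equal size, \<open>a i \<noteq> a j\<close> forces
  \<open>\<gamma> = 0\<close>. Otherwise the weight of the larger block is nonzero, and the relation expresses each \<open>\<gamma> s\<close>
  through a coefficient of smaller index or as zero. This is why a zero weight is only allowed at a block of
  minimal size.
\<close>

lemma stabiliser_block_diagonal:
  assumes inj: "inj_on a {..<k}" and a0: "\<And>i j. \<lbrakk>i < k; j < k; a i = 0\<rbrakk> \<Longrightarrow> m i \<le> m j"
    and f: "f \<in> Z" and stab: "\<And>g. g \<in> Z \<Longrightarrow> diag_form a (commutator f g) = 0"
    and ij: "i < k" "j < k" "i \<noteq> j" and s: "s < m j"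
  shows "c (j, s) (f (u i 0)) = 0"
  using s
proof (induction s rule: less_induct)
  case (less s)
  define \<gamma> where "\<gamma> r = c (j, r) (f (u i 0))" for r
  have rel: "a j * (if t < m j then \<gamma> (m j - 1 - t) else 0) = a i * \<gamma> (m i - 1 - t)"
    if "m i \<le> m j + t" "t < m i" for t
    unfolding \<gamma>_def
    using diag_form_commutator[OF f ij(1,2) that, of a] stab[OF block_map_Z[OF ij(2,1) that(1)]]
    by (metis right_minus_eq)
  have neq: "a i \<noteq> a j"
    using inj ij by (auto simp: inj_on_def)
  consider "m i = m j" | "m i < m j" | "m j < m i" by linarith
  then have "\<gamma> s = 0"
  proof cases
    case 1
    have "a j * \<gamma> s = a i * \<gamma> s"
      using rel[of "m j - 1 - s"] 1 less.prems by simp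
    then show ?thesis using neq by auto
  next
    case 2
    then have aj: "a j \<noteq> 0" using a0[of j i] ij by auto
    show ?thesis
    proof (cases "s + m i < m j")
      case True
      then show ?thesis using Z_vanish[OF f ij(1,2)] by (simp add: \<gamma>_def)
    next
      case False
      define t where "t = m j - 1 - s"
      have t: "t < m i" "t < m j" "m j - 1 - t = s" "m i - 1 - t < s" "m i - 1 - t < m j"
        using False 2 less.prems by (auto simp: t_def)
      have "\<gamma> (m i - 1 - t) = 0"
        using less.IH[OF t(4,5)] by (simp add: \<gamma>_def)
      then show ?thesis
        using rel[of t] t 2 aj by simp
    qed
  next
    case 3
    then have ai: "a i \<noteq> 0" using a0[of i j] ij by auto
    define t where "t = m i - 1 - s"
    have t: "m i \<le> m j + t" "t < m i" "m i - 1 - t = s"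
      using 3 less.prems by (auto simp: t_def)
    have "(if t < m j then \<gamma> (m j - 1 - t) else 0) = 0"
    proof (cases "t < m j")
      case True
      then have "m j - 1 - t < s"
        using 3 less.prems by (auto simp: t_def)
      then show ?thesis
        using less.IH[of "m j - 1 - t"] less.prems by (simp add: \<gamma>_def)
    qed simp
    then show ?thesis
      using rel[OF t(1,2)] t(3) ai by simp
  qed
  then show ?case by (simp add: \<gamma>_def)
qed

text \<open>
  A stabilising \<open>f\<close> preserves every block and therefore acts on block \<open>i\<close> as a polynomial in \<open>e\<close>; the
  spanning maps are the powers of \<open>e\<close> restricted to single blocks.
\<close>

lemma stabiliser_span:
  assumes inj: "inj_on a {..<k}" and a0: "\<And>i j. \<lbrakk>i < k; j < k; a i = 0\<rbrakk> \<Longrightarrow> m i \<le> m j"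
    and f: "f \<in> Z" and stab: "\<And>g. g \<in> Z \<Longrightarrow> diag_form a (commutator f g) = 0"
  shows "f \<in> E.span ((\<lambda>(i, s). block_map i i s) ` (SIGMA i:{..<k}. {..<m i}))"
proof -
  let ?I = "SIGMA i:{..<k}. {..<m i}"
  define g where "g = (\<Sum>p\<in>?I. End_scale scale (c p (f (u (fst p) 0))) (block_map (fst p) (fst p) (snd p)))"
  have g_app: "g x = (\<Sum>i<k. \<Sum>s<m i. scale (c (i, s) (f (u i 0))) (block_map i i s x))" for x
    unfolding g_def sum_fun_apply by (simp add: sum.Sigma End_scale_def case_prod_unfold)
  have g_span: "g \<in> E.span ((\<lambda>(i, s). block_map i i s) ` ?I)"
    unfolding g_def
    by (intro E.span_sum E.span_scale E.span_base) (auto intro!: image_eqI[rotated])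
  have "E.subspace (gl scale)"
    by (rule E.subspaceI) (auto simp: gl_iff End_scale_def scale_right_distrib mult.commute algebra_simps)
  then have g_gl: "g \<in> gl scale"
    unfolding g_def by (auto intro!: E.subspace_sum E.subspace_scale block_map_gl)
  have f_gl: "f \<in> gl scale" using f by (simp add: Z_iff)
  have "f = g"
  proof (rule gl_eqI[OF f_gl g_gl])
    fix p assume "p \<in> ?I"
    then obtain l r where p: "p = (l, r)" "l < k" "r < m l" by auto
    have off: "c (j, s) (f (u l 0)) = 0" if "j < k" "j \<noteq> l" "s < m j" for j s
      by (rule stabiliser_block_diagonal[OF inj _ f stab]) (use a0 p(2) that in blast)+
    have shift: "f (u l r) = (\<Sum>s<m l. scale (c (l, s) (f (u l 0))) (u l (s + r)))"
    proof (induction r)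
      case 0
      have "f (u l 0) = (\<Sum>i<k. \<Sum>s<m i. scale (c (i, s) (f (u l 0))) (u i s))"
        by (simp only: expansion')
      also have "\<dots> = (\<Sum>i<k. if i = l then \<Sum>s<m i. scale (c (i, s) (f (u l 0))) (u i s) else 0)"
        by (intro sum.cong) (auto simp: off)
      also have "\<dots> = (\<Sum>s<m l. scale (c (l, s) (f (u l 0))) (u l s))"
        using p(2) by simp
      finally show ?case by simp
    next
      case (Suc r)
      have "f (u l (Suc r)) = e (f (u l r))"
        using f p(2) by (simp add: Z_iff e_u'[symmetric])
      then show ?case
        by (simp add: Suc.IH gl_sum[OF e] gl_scale[OF e] e_u' p(2))
    qed
    have "g (u l r) = (\<Sum>i<k. if i = l then \<Sum>s<m i. scale (c (i, s) (f (u i 0))) (u i (s + r)) else 0)"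
      unfolding g_app using p(2) by (intro sum.cong) (auto simp: block_map_u add.commute)
    also have "\<dots> = f (u l r)"
      using p(2) by (simp add: shift)
    finally show "f (case p of (i, s) \<Rightarrow> u i s) = g (case p of (i, s) \<Rightarrow> u i s)"
      by (simp add: p(1))
  qed
  with g_span show ?thesis by simp
qed

end

text \<open>
  Translating \<open>k\<close> distinct scalars moves the possible zero to a prescribed index, and a minimum of
  \<open>m\<close> is chosen for it. This avoids asking for \<open>k\<close> distinct nonzero scalars.
\<close>

lemma exists_distinct_weights:
  fixes m :: "nat \<Rightarrow> nat"
  assumes "infinite (UNIV :: 'a::field set) \<or> k \<le> card (UNIV :: 'a::field set)"
  obtains a :: "nat \<Rightarrow> 'a::field" where "inj_on a {..<k}"
    "\<And>i j. \<lbrakk>i < k; j < k; a i = 0\<rbrakk> \<Longrightarrow> m i \<le> m j"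
proof -
  obtain S :: "'a set" where S: "finite S" "card S = k"
    using assms obtain_subset_with_card_n[of k "UNIV :: 'a set"]
      infinite_arbitrarily_large[of "UNIV :: 'a set" k] by metis
  then obtain f where "bij_betw f {0..<k} S"
    using ex_bij_betw_nat_finite by blast
  then have f: "inj_on f {..<k}"
    by (auto simp: bij_betw_def lessThan_atLeast0)
  show ?thesis
  proof (cases "k = 0")
    case True
    then show ?thesis using that[of "\<lambda>_. 0"] by simp
  next
    case False
    define i0 where "i0 = arg_min_on m {..<k}"
    have i0: "i0 < k" "\<And>j. j < k \<Longrightarrow> m i0 \<le> m j"
      using arg_min_if_finite[of "{..<k}" m] False by (auto simp: i0_def not_less)
    have "i = i0" if "i < k" "f i - f i0 = 0" for i
      using f i0(1) that by (auto simp: inj_on_def)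
    then show ?thesis
      using that[of "\<lambda>i. f i - f i0"] f i0 by (auto simp: inj_on_def)
  qed
qed

section \<open>Existence of Jordan bases\<close>

lemma mult_mat_entry:
  assumes "A \<in> carrier_mat n n" "B \<in> carrier_mat n n" "i < n" "j < n"
  shows "(A * B) $$ (i, j) = (\<Sum>l<n. A $$ (i, l) * B $$ (l, j))"
  using assms by (auto simp: scalar_prod_def lessThan_atLeast0 intro!: sum.cong)

text \<open>
  The bijection \<open>g\<close> sends \<open>(i, s)\<close> to the position of \<open>e ^ s\<close> applied to the generator of block \<open>i\<close>.
  Each block is run through from its last index to its first, since the ones of a Jordan block
  stand above the diagonal and its last basis vector is the cyclic one.
\<close>

lemma jordan_matrix_chains:
  fixes n_as :: "(nat \<times> 'a::field) list"
  defines "N \<equiv> sum_list (map fst n_as)" and "m \<equiv> \<lambda>i. fst (n_as ! i)"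
  shows "\<exists>g. bij_betw g (SIGMA i:{..<length n_as}. {..<m i}) {..<N} \<and>
    (\<forall>i<length n_as. \<forall>s<m i. \<forall>r<N. jordan_matrix n_as $$ (r, g (i, s)) =
      (if r = g (i, s) then snd (n_as ! i) else 0) +
      (if Suc s < m i \<and> r = g (i, Suc s) then 1 else 0))"
  unfolding N_def m_def
proof (induction n_as)
  case Nil
  then show ?case by (intro exI[of _ "\<lambda>_. 0"]) (auto simp: bij_betw_def)
next
  case (Cons na xs)
  obtain m a where na: "na = (m, a)" by (cases na)
  let ?N = "sum_list (map fst xs)"
  let ?I = "SIGMA i:{..<length xs}. {..<fst (xs ! i)}"
  obtain g where bij: "bij_betw g ?I {..<?N}"
    and g: "\<And>i s r. \<lbrakk>i < length xs; s < fst (xs ! i); r < ?N\<rbrakk> \<Longrightarrow> jordan_matrix xs $$ (r, g (i, s)) =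
      (if r = g (i, s) then snd (xs ! i) else 0) +
      (if Suc s < fst (xs ! i) \<and> r = g (i, Suc s) then 1 else 0)"
    using Cons.IH by blast
  have gN: "g (i, s) < ?N" if "i < length xs" "s < fst (xs ! i)" for i s
    using bij_betw_apply[OF bij, of "(i, s)"] that by simp
  define h where "h = (\<lambda>(i, s). case i of 0 \<Rightarrow> m - 1 - s | Suc i' \<Rightarrow> m + g (i', s))"
  have h: "h (0, s) = m - 1 - s" "h (Suc i, s) = m + g (i, s)" for i s
    by (simp_all add: h_def)
  let ?J = "SIGMA i:{..<length (na # xs)}. {..<fst ((na # xs) ! i)}"
  have J: "(i, s) \<in> ?J \<longleftrightarrow> (case i of 0 \<Rightarrow> s < m | Suc i' \<Rightarrow> (i', s) \<in> ?I)" for i s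
    by (cases i) (auto simp: na)
  have "bij_betw h ?J {..<m + ?N}"
  proof (rule bij_betw_imageI)
    show "inj_on h ?J"
    proof (rule inj_onI)
      fix p p' assume *: "p \<in> ?J" "p' \<in> ?J" "h p = h p'"
      obtain i s where p: "p = (i, s)" by (cases p)
      obtain i' s' where p': "p' = (i', s')" by (cases p')
      have inj: "inj_on g ?I" using bij by (rule bij_betw_imp_inj_on)
      show "p = p'"
        using * unfolding p p' J
        by (cases i; cases i') (auto simp: h dest: inj_onD[OF inj])
    qed
    show "h ` ?J = {..<m + ?N}"
    proof
      show "h ` ?J \<subseteq> {..<m + ?N}"
      proof (rule image_subsetI)
        fix p assume "p \<in> ?J"
        moreover obtain i s where p: "p = (i, s)" by (cases p)
        ultimately show "h p \<in> {..<m + ?N}"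
          unfolding p J using gN by (cases i) (auto simp: h)
      qed
      show "{..<m + ?N} \<subseteq> h ` ?J"
      proof
        fix r assume r: "r \<in> {..<m + ?N}"
        show "r \<in> h ` ?J"
        proof (cases "r < m")
          case True
          then have "r = h (0, m - 1 - r)" "(0, m - 1 - r) \<in> ?J"
            unfolding J by (auto simp: h)
          then show ?thesis by (rule image_eqI)
        next
          case False
          then have "r - m \<in> g ` ?I"
            using bij r by (auto simp: bij_betw_def)
          then obtain i s where ij: "(i, s) \<in> ?I" "r - m = g (i, s)" by auto
          have "r = h (Suc i, s)" "(Suc i, s) \<in> ?J"
            unfolding J using False ij by (auto simp: h)
          then show ?thesis by (rule image_eqI)
        qed
      qed
    qed
  qed
  moreover have "jordan_matrix (na # xs) $$ (r, h (i, s)) =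
      (if r = h (i, s) then snd ((na # xs) ! i) else 0) +
      (if Suc s < fst ((na # xs) ! i) \<and> r = h (i, Suc s) then 1 else 0)"
    if "i < length (na # xs)" "s < fst ((na # xs) ! i)" "r < m + ?N" for i s r
  proof -
    have jm: "jordan_matrix (na # xs) =
        four_block_mat (jordan_block m a) (0\<^sub>m m ?N) (0\<^sub>m ?N m) (jordan_matrix xs)"
      using jordan_matrix_dim[of xs] by (simp add: jordan_matrix_def na Let_def)
    show ?thesis
    proof (cases i)
      case 0
      then show ?thesis
        using that unfolding jm by (auto simp: na h)
    next
      case (Suc i')
      have "jordan_matrix (na # xs) $$ (r, h (i, s)) =
          (if r < m then 0 else jordan_matrix xs $$ (r - m, g (i', s)))"
        using that Suc gN[of i' s] unfolding jm by (auto simp: h)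
      then show ?thesis
        using that Suc g[of i' s "r - m"] by (auto simp: h)
    qed
  qed
  ultimately show ?case
    by (intro exI[of _ h]) (simp add: na)
qed

lemma ordered_basis_dual_basis:
  fixes scale :: "'a::field \<Rightarrow> 'b::ab_group_add \<Rightarrow> 'b"
  assumes "vector_space scale" "ordered_basis scale bs"
  shows "dual_basis scale {..<length bs} (\<lambda>i. bs ! i)
    (\<lambda>i x. module.representation scale (set bs) x (bs ! i))"
proof -
  interpret vector_space scale by fact
  have bs: "distinct bs" "independent (set bs)" "span (set bs) = UNIV"
    using assms(2) by (auto simp: ordered_basis_def)
  show ?thesis
  proof
    show "representation (set bs) (x + y) (bs ! i)
        = representation (set bs) x (bs ! i) + representation (set bs) y (bs ! i)" for x y i
      using bs by (simp add: representation_add)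
    show "representation (set bs) (scale r x) (bs ! i) = r * representation (set bs) x (bs ! i)" for r x i
      using bs by (simp add: representation_scale)
    show "representation (set bs) (bs ! j) (bs ! i) = (if i = j then 1 else 0)"
      if "i \<in> {..<length bs}" "j \<in> {..<length bs}" for i j
      using that bs by (auto simp: representation_basis nth_eq_iff_index_eq)
    show "(\<Sum>i<length bs. scale (representation (set bs) x (bs ! i)) (bs ! i)) = x" for x
    proof -
      have "(\<Sum>i<length bs. scale (representation (set bs) x (bs ! i)) (bs ! i))
          = (\<Sum>b\<in>set bs. scale (representation (set bs) x b) b)"
        using bij_betw_nth[OF bs(1) refl refl]
        by (rule sum.reindex_bij_betw)
      also have "\<dots> = x"
        by (rule sum_representation_eq) (use bs in auto)
      finally show ?thesis .
    qed
  qed simp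
qed

lemma dual_basis_change:
  assumes "dual_basis scale {..<n} u c"
    and P: "P \<in> carrier_mat n n" and Q: "Q \<in> carrier_mat n n"
    and PQ: "P * Q = 1\<^sub>m n" and QP: "Q * P = 1\<^sub>m n"
  shows "dual_basis scale {..<n} (\<lambda>j. \<Sum>i<n. scale (P $$ (i, j)) (u i))
    (\<lambda>j x. \<Sum>i<n. Q $$ (j, i) * c i x)"
proof -
  interpret dual_basis scale "{..<n}" u c by fact
  show ?thesis
  proof
    show "(\<Sum>l<n. Q $$ (i, l) * c l (x + y)) = (\<Sum>l<n. Q $$ (i, l) * c l x) + (\<Sum>l<n. Q $$ (i, l) * c l y)"
      for i x y
      unfolding sum.distrib[symmetric] by (intro sum.cong) (auto simp: coord_add distrib_left)
    show "(\<Sum>l<n. Q $$ (i, l) * c l (scale r x)) = r * (\<Sum>l<n. Q $$ (i, l) * c l x)" for i r x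
      unfolding sum_distrib_left by (intro sum.cong) (auto simp: coord_scale)
    show "(\<Sum>l<n. Q $$ (i, l) * c l (\<Sum>r<n. scale (P $$ (r, j)) (u r))) = (if i = j then 1 else 0)"
      if ij: "i \<in> {..<n}" "j \<in> {..<n}" for i j
    proof -
      have "c l (\<Sum>r<n. scale (P $$ (r, j)) (u r)) = P $$ (l, j)" if "l < n" for l
      proof -
        have "c l (\<Sum>r<n. scale (P $$ (r, j)) (u r)) = (\<Sum>r<n. P $$ (r, j) * (if l = r then 1 else 0))"
          using that by (auto simp: coord_sum coord_scale coord_basis intro!: sum.cong)
        then show ?thesis using that by (simp add: if_distrib cong: if_cong)
      qed
      then have "(\<Sum>l<n. Q $$ (i, l) * c l (\<Sum>r<n. scale (P $$ (r, j)) (u r))) = (Q * P) $$ (i, j)"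
        using mult_mat_entry[OF Q P] ij by simp
      then show ?thesis using ij by (simp add: QP)
    qed
    show "(\<Sum>j<n. scale (\<Sum>i<n. Q $$ (j, i) * c i x) (\<Sum>l<n. scale (P $$ (l, j)) (u l))) = x" for x
    proof -
      have "(\<Sum>j<n. scale (\<Sum>i<n. Q $$ (j, i) * c i x) (\<Sum>l<n. scale (P $$ (l, j)) (u l)))
          = (\<Sum>j<n. \<Sum>l<n. scale (\<Sum>i<n. P $$ (l, j) * Q $$ (j, i) * c i x) (u l))"
        by (simp add: scale_sum_right sum_distrib_right sum_distrib_left mult_ac)
      also have "\<dots> = (\<Sum>l<n. scale (\<Sum>j<n. \<Sum>i<n. P $$ (l, j) * Q $$ (j, i) * c i x) (u l))"
        by (subst sum.swap) (simp add: scale_sum_left)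
      also have "\<dots> = (\<Sum>l<n. scale (c l x) (u l))"
      proof (rule sum.cong[OF refl])
        fix l assume l: "l \<in> {..<n}"
        have "(\<Sum>j<n. \<Sum>i<n. P $$ (l, j) * Q $$ (j, i) * c i x) = (\<Sum>i<n. (P * Q) $$ (l, i) * c i x)"
          by (subst sum.swap) (use l in \<open>simp add: mult_mat_entry[OF P Q] sum_distrib_right\<close>)
        also have "\<dots> = (\<Sum>i<n. if i = l then c i x else 0)"
          using l by (intro sum.cong) (auto simp: PQ)
        finally show "scale (\<Sum>j<n. \<Sum>i<n. P $$ (l, j) * Q $$ (j, i) * c i x) (u l) = scale (c l x) (u l)"
          using l by simp
      qed
      also have "\<dots> = x" by (rule expansion)
      finally show ?thesis .
    qed
  qed simp
qed

text \<open>
  Entry \<open>j\<close> of the new basis is column \<open>j\<close> of \<open>P\<close>, so the matrix \<open>J\<close> of \<open>f\<close> in it satisfies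
  \<open>A P = P J\<close>.
\<close>

lemma represents_change:
  assumes "dual_basis scale {..<n} u c" and f: "f \<in> gl scale"
    and P: "P \<in> carrier_mat n n" and A: "A \<in> carrier_mat n n" and J: "J \<in> carrier_mat n n"
    and AP: "A * P = P * J"
    and rep: "\<And>j. j < n \<Longrightarrow> f (u j) = (\<Sum>i<n. scale (A $$ (i, j)) (u i))"
    and j: "j < n"
  shows "f (\<Sum>i<n. scale (P $$ (i, j)) (u i))
    = (\<Sum>r<n. scale (J $$ (r, j)) (\<Sum>i<n. scale (P $$ (i, r)) (u i)))"
proof -
  interpret dual_basis scale "{..<n}" u c by fact
  have "f (\<Sum>i<n. scale (P $$ (i, j)) (u i)) = (\<Sum>i<n. \<Sum>l<n. scale (A $$ (l, i) * P $$ (i, j)) (u l))"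
    by (simp add: gl_sum[OF f] gl_scale[OF f] rep scale_sum_right mult.commute)
  also have "\<dots> = (\<Sum>l<n. scale ((A * P) $$ (l, j)) (u l))"
    by (subst sum.swap) (simp add: mult_mat_entry[OF A P] j scale_sum_left)
  also have "\<dots> = (\<Sum>l<n. \<Sum>r<n. scale (P $$ (l, r) * J $$ (r, j)) (u l))"
    by (simp add: AP mult_mat_entry[OF P J] j scale_sum_left)
  also have "\<dots> = (\<Sum>r<n. scale (J $$ (r, j)) (\<Sum>i<n. scale (P $$ (i, r)) (u i)))"
    by (subst sum.swap) (simp add: scale_sum_right mult.commute)
  finally show ?thesis .
qed

lemma dual_basis_cong:
  assumes "dual_basis scale I u c" and u: "\<And>i. i \<in> I \<Longrightarrow> u' i = u i"
  shows "dual_basis scale I u' c"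
proof -
  interpret dual_basis scale I u c by fact
  show ?thesis
    by unfold_locales
      (use u expansion in \<open>auto simp: finite_I coord_add coord_scale coord_basis cong: sum.cong\<close>)
qed

text \<open>
  The columns of a matrix that conjugates to the Jordan normal form are a Jordan basis. All
  eigenvalues vanish because the first vector of each block is an eigenvector of a nilpotent map.
\<close>

lemma exists_jordan_basis:
  assumes vs: "vector_space scale" and e: "e \<in> gl scale" and nil: "nilpotent_map e"
    and blocks: "has_jordan_blocks scale e k"
  obtains m u c where "jordan_basis scale k m u c e"
proof -
  obtain bs A n_as where bs: "ordered_basis scale bs" "represents scale bs A e"
    and jnf: "jordan_nf A n_as" and k: "length n_as = k"
    using blocks by (auto simp: has_jordan_blocks_def)
  define n where "n = length bs"
  define J where "J = jordan_matrix n_as"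
  have A: "A \<in> carrier_mat n n"
    and rep: "\<And>j. j < n \<Longrightarrow> e (bs ! j) = (\<Sum>i<n. scale (A $$ (i, j)) (bs ! i))"
    using bs(2) by (auto simp: represents_def n_def)
  obtain P Q where "similar_mat_wit A J P Q"
    using jnf by (auto simp: jordan_nf_def similar_mat_def J_def)
  note PQ = similar_mat_witD2[OF A this]
  have N: "sum_list (map fst n_as) = n"
    using carrier_matD(1)[OF PQ(5)] by (simp add: J_def)
  have PJ: "P * J \<in> carrier_mat n n"
    using PQ(5,6) by (rule mult_carrier_mat[rotated])
  have "A * P = P * J * Q * P"
    by (rule arg_cong[OF PQ(3)])
  also have "\<dots> = P * J * (Q * P)"
    by (rule assoc_mult_mat[OF PJ PQ(7,6)])
  finally have AP: "A * P = P * J"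
    by (simp only: PQ(2) right_mult_one_mat[OF PJ])
  define v where "v = (\<lambda>j. \<Sum>i<n. scale (P $$ (i, j)) (bs ! i))"
  note D0 = ordered_basis_dual_basis[OF vs bs(1), folded n_def]
  obtain c where D1: "dual_basis scale {..<n} v c"
    using dual_basis_change[OF D0 PQ(6,7,1,2)] by (auto simp: v_def)
  interpret D1: dual_basis scale "{..<n}" v c by fact
  have ev: "e (v j) = (\<Sum>r<n. scale (J $$ (r, j)) (v r))" if "j < n" for j
    unfolding v_def by (rule represents_change[OF D0 e PQ(6) A PQ(5) AP rep that])
  define m where "m i = fst (n_as ! i)" for i
  let ?I = "SIGMA i:{..<k}. {..<m i}"
  obtain g where bij: "bij_betw g ?I {..<n}"
    and g: "\<And>i s r. \<lbrakk>i < k; s < m i; r < n\<rbrakk> \<Longrightarrow> J $$ (r, g (i, s)) =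
      (if r = g (i, s) then snd (n_as ! i) else 0) +
      (if Suc s < m i \<and> r = g (i, Suc s) then 1 else 0)"
    using jordan_matrix_chains[of n_as] unfolding N k J_def[symmetric] m_def[symmetric] by blast
  have gn: "g (i, s) < n" if "i < k" "s < m i" for i s
    using bij_betw_apply[OF bij, of "(i, s)"] that by simp
  have chain: "e (v (g (i, s))) = scale (snd (n_as ! i)) (v (g (i, s)))
      + (if Suc s < m i then v (g (i, Suc s)) else 0)" if "i < k" "s < m i" for i s
  proof -
    have "e (v (g (i, s))) = (\<Sum>r<n. (if r = g (i, s) then scale (snd (n_as ! i)) (v r) else 0)
        + (if r = g (i, Suc s) then if Suc s < m i then v r else 0 else 0))"
      unfolding ev[OF gn[OF that]]
      by (intro sum.cong) (auto simp: g that D1.scale_left_distrib)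
    then show ?thesis
      using gn[OF that] gn[of i "Suc s"] that by (auto simp: sum.distrib)
  qed
  have m_pos: "0 < m i" if "i < k" for i
    using jnf that k nth_mem[of i n_as] by (force simp: jordan_nf_def m_def)
  have eigenvalue: "snd (n_as ! i) = 0" if i: "i < k" for i
  proof -
    \<comment> \<open>the end of the chain is an eigenvector\<close>
    define a w where "a = snd (n_as ! i)" and "w = v (g (i, m i - 1))"
    have gi: "g (i, m i - 1) < n"
      using gn[of i "m i - 1"] i m_pos[OF i] by simp
    have ew: "e w = scale a w"
      using chain[of i "m i - 1"] i m_pos[OF i] by (simp add: a_def w_def)
    have pow: "(e ^^ l) w = scale (a ^ l) w" for l
      by (induction l) (simp_all add: ew D1.gl_scale[OF e] mult.commute)
    obtain l where "(e ^^ l) w = 0"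
      using nil by (auto simp: nilpotent_map_def)
    then have zero: "scale (a ^ l) w = 0"
      by (simp only: pow)
    have "c (g (i, m i - 1)) (scale (a ^ l) w) = 0"
      unfolding zero using gi by (simp add: D1.coord_zero)
    then show ?thesis
      using gi by (simp add: D1.coord_scale D1.coord_basis w_def a_def)
  qed
  define u where "u i s = (if s < m i then v (g (i, s)) else 0)" for i s
  have "dual_basis scale ?I (\<lambda>(i, s). u i s) (c \<circ> g)"
    by (rule dual_basis_cong[OF D1.reindex[OF bij]]) (auto simp: u_def)
  then have "jordan_basis scale k m u (c \<circ> g) e"
    by (intro jordan_basis.intro jordan_basis_axioms.intro)
      (use e chain eigenvalue m_pos in \<open>auto simp: u_def\<close>)
  then show ?thesis by (rule that)
qed

section \<open>Polynomials commuting with a deformation\<close>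

text \<open>
  A sequence \<open>P\<close> of endomorphisms stands for the polynomial \<open>\<Sum>m. t ^ m P m\<close> with coefficients in
  \<open>gl(V)\<close>, so this shift is multiplication by \<open>t\<close>.
\<close>

definition tshift :: "(nat \<Rightarrow> 'v::zero) \<Rightarrow> nat \<Rightarrow> 'v" where
  "tshift P m = (case m of 0 \<Rightarrow> 0 | Suc l \<Rightarrow> P l)"

lemma tshift_simps [simp]: "tshift P 0 = 0" "tshift P (Suc m) = P m"
  by (simp_all add: tshift_def)

lemma tshift_power: "(tshift ^^ j) P m = (if m < j then 0 else P (m - j))"
proof (induction j arbitrary: m)
  case (Suc j)
  then show ?case by (cases m) auto
qed simp

text \<open>
  The products \<open>x P\<close> and \<open>P x\<close> of polynomials, for the deformation \<open>x = e + t y + t\<^sup>2 z\<close> of \<open>e\<close>.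
\<close>

definition pencil_left ::
    "('b \<Rightarrow> 'b) \<Rightarrow> ('b \<Rightarrow> 'b) \<Rightarrow> ('b \<Rightarrow> 'b) \<Rightarrow> (nat \<Rightarrow> 'b \<Rightarrow> 'b) \<Rightarrow> nat \<Rightarrow> 'b::ab_group_add \<Rightarrow> 'b" where
  "pencil_left e y z P m x = e (P m x) + y (tshift P m x) + z (tshift (tshift P) m x)"

definition pencil_right ::
    "('b \<Rightarrow> 'b) \<Rightarrow> ('b \<Rightarrow> 'b) \<Rightarrow> ('b \<Rightarrow> 'b) \<Rightarrow> (nat \<Rightarrow> 'b \<Rightarrow> 'b) \<Rightarrow> nat \<Rightarrow> 'b::ab_group_add \<Rightarrow> 'b" where
  "pencil_right e y z P m x = P m (e x) + tshift P m (y x) + tshift (tshift P) m (z x)"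

text \<open>
  The polynomials of degree less than \<open>d\<close> that commute with \<open>x = e + t y + t\<^sup>2 z\<close>.
\<close>

definition commuting_polys ::
    "('a::field \<Rightarrow> 'b::ab_group_add \<Rightarrow> 'b) \<Rightarrow> ('b \<Rightarrow> 'b) \<Rightarrow> ('b \<Rightarrow> 'b) \<Rightarrow> ('b \<Rightarrow> 'b) \<Rightarrow> nat \<Rightarrow>
      (nat \<Rightarrow> 'b \<Rightarrow> 'b) set" where
  "commuting_polys scale e y z d =
     {P. (\<forall>m. P m \<in> gl scale) \<and> (\<forall>m\<ge>d. P m = 0) \<and> pencil_left e y z P = pencil_right e y z P}"

definition poly_scale :: "('a \<Rightarrow> 'b \<Rightarrow> 'b) \<Rightarrow> 'a \<Rightarrow> (nat \<Rightarrow> 'b \<Rightarrow> 'b) \<Rightarrow> nat \<Rightarrow> 'b \<Rightarrow> 'b" where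
  "poly_scale scale r P = (\<lambda>m. End_scale scale r (P m))"

text \<open>
  In the application \<open>y\<close> represents a given functional through the trace form, while the cyclic
  shift \<open>z\<close> is an auxiliary term. It makes the powers of \<open>x\<close> independent over the polynomials, and as
  it enters with \<open>t\<^sup>2\<close> it is invisible in the coefficients of \<open>1\<close> and \<open>t\<close>, from which the
  stabiliser is read off.
\<close>

locale pencil = dual_basis scale "{..<n}" u c
  for scale :: "'a::field \<Rightarrow> 'b::ab_group_add \<Rightarrow> 'b" and n :: nat and u c +
  fixes e y z :: "'b \<Rightarrow> 'b"
  assumes e: "e \<in> gl scale" and y: "y \<in> gl scale" and z: "z \<in> gl scale"
    and z_basis: "Suc i < n \<Longrightarrow> z (u i) = u (Suc i)"
begin

abbreviation L where "L \<equiv> pencil_left e y z"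
abbreviation R where "R \<equiv> pencil_right e y z"
abbreviation M where "M \<equiv> commuting_polys scale e y z"

sublocale E: vector_space "End_scale scale"
  by (rule vector_space_End_scale) (rule vector_space_axioms)

sublocale P: vector_space "poly_scale scale"
  by unfold_locales
    (auto simp: poly_scale_def fun_eq_iff E.scale_right_distrib E.scale_left_distrib
      End_scale_def scale_right_distrib scale_left_distrib)

lemma M_coeff_gl: "P \<in> M d \<Longrightarrow> P m \<in> gl scale"
  and M_degree: "P \<in> M d \<Longrightarrow> d \<le> m \<Longrightarrow> P m x = 0"
  and M_commute: "P \<in> M d \<Longrightarrow> L P m x = R P m x"
  by (auto simp: commuting_polys_def fun_eq_iff)

lemma M_I:
  assumes "\<And>m. P m \<in> gl scale" "\<And>m x. d \<le> m \<Longrightarrow> P m x = 0" "\<And>m x. L P m x = R P m x"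
  shows "P \<in> M d"
  using assms by (auto simp: commuting_polys_def fun_eq_iff)

lemma tshift_add: "tshift (P + Q) m x = tshift P m x + tshift Q m x"
  for P Q :: "nat \<Rightarrow> 'b \<Rightarrow> 'b"
  by (cases m) auto

lemma tshift_scale: "tshift (poly_scale scale r P) m x = scale r (tshift P m x)"
  by (cases m) (auto simp: poly_scale_def End_scale_def)

lemma poly_scale_apply: "poly_scale scale r P m x = scale r (P m x)"
  by (simp add: poly_scale_def End_scale_def)

lemma tshift2_add: "tshift (tshift (P + Q)) m x = tshift (tshift P) m x + tshift (tshift Q) m x"
  for P Q :: "nat \<Rightarrow> 'b \<Rightarrow> 'b"
  by (cases m) (auto simp: tshift_add)

lemma tshift2_scale: "tshift (tshift (poly_scale scale r P)) m x = scale r (tshift (tshift P) m x)"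
  by (cases m) (auto simp: tshift_scale)

lemma subspace_M: "P.subspace (M d)"
proof (rule P.subspaceI)
  show "0 \<in> M d"
  proof (rule M_I)
    have "tshift (0 :: nat \<Rightarrow> 'b \<Rightarrow> 'b) = 0"
      by (auto simp: tshift_def fun_eq_iff split: nat.split)
    then show "L 0 m x = R 0 m x" for m x
      by (simp add: pencil_left_def pencil_right_def gl_zero e y z)
  qed (simp_all add: zero_in_gl)
  show "P + Q \<in> M d" if PQ: "P \<in> M d" "Q \<in> M d" for P Q
  proof (rule M_I)
    show "(P + Q) m \<in> gl scale" for m
      using PQ by (simp add: gl_plus M_coeff_gl)
    show "(P + Q) m x = 0" if "d \<le> m" for m x
      using PQ that by (simp add: M_degree fun_eq_iff)
    have "L (P + Q) m x = L P m x + L Q m x" for m x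
      by (simp add: pencil_left_def tshift_add tshift2_add gl_add e y z)
    moreover have "R (P + Q) m x = R P m x + R Q m x" for m x
      by (simp add: pencil_right_def tshift_add tshift2_add)
    ultimately show "L (P + Q) m x = R (P + Q) m x" for m x
      using PQ by (simp add: M_commute)
  qed
  show "poly_scale scale r P \<in> M d" if P: "P \<in> M d" for r P
  proof (rule M_I)
    show "poly_scale scale r P m \<in> gl scale" for m
      using P by (simp add: poly_scale_def gl_End_scale M_coeff_gl)
    show "poly_scale scale r P m x = 0" if "d \<le> m" for m x
      using P that by (simp add: poly_scale_def M_degree End_scale_def fun_eq_iff)
    have "L (poly_scale scale r P) m x = scale r (L P m x)" for m x
      by (simp add: pencil_left_def poly_scale_apply tshift_scale tshift2_scale gl_scale e y z
          scale_right_distrib)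
    moreover have "R (poly_scale scale r P) m x = scale r (R P m x)" for m x
      by (simp add: pencil_right_def poly_scale_apply tshift_scale tshift2_scale
          scale_right_distrib)
    ultimately show "L (poly_scale scale r P) m x = R (poly_scale scale r P) m x" for m x
      using P by (simp add: M_commute)
  qed
qed

lemma pencil_tshift: "L (tshift P) m x = tshift (L P) m x" "R (tshift P) m x = tshift (R P) m x"
  by (cases m; simp add: pencil_left_def pencil_right_def gl_zero e y z)+

text \<open>
  Multiplication by \<open>t\<close> is central and injective, so a commuting polynomial with vanishing constant
  term is \<open>t\<close> times a commuting polynomial.
\<close>

lemma tshift_M_iff: "tshift P \<in> M (Suc d) \<longleftrightarrow> P \<in> M d"
proof
  assume T: "tshift P \<in> M (Suc d)"
  show "P \<in> M d"
  proof (rule M_I)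
    show "P m \<in> gl scale" for m
      using M_coeff_gl[OF T, of "Suc m"] by simp
    show "P m x = 0" if "d \<le> m" for m x
      using M_degree[OF T, of "Suc m" x] that by simp
    show "L P m x = R P m x" for m x
      using M_commute[OF T, of "Suc m" x] by (simp add: pencil_tshift)
  qed
next
  assume P: "P \<in> M d"
  show "tshift P \<in> M (Suc d)"
  proof (rule M_I)
    show "tshift P m \<in> gl scale" for m
      using P by (cases m) (simp_all add: zero_in_gl M_coeff_gl)
    show "tshift P m x = 0" if "Suc d \<le> m" for m x
      using P that by (cases m) (simp_all add: M_degree)
    show "L (tshift P) m x = R (tshift P) m x" for m x
      using P by (cases m) (simp_all add: pencil_tshift M_commute)
  qed
qed

lemma tshift_power_M: "P \<in> M d \<Longrightarrow> (tshift ^^ j) P \<in> M (d + j)"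
  by (induction j) (simp_all add: tshift_M_iff)

lemma M_mono: "d \<le> d' \<Longrightarrow> M d \<subseteq> M d'"
  by (auto simp: commuting_polys_def)

text \<open>
  The evaluation \<open>P \<mapsto> P 0\<close> on commuting polynomials of degree less than \<open>d + 1\<close> has its image
  in the span of \<open>B\<close>, and by \<open>tshift_M_iff\<close> its kernel is \<open>t\<close> times the space for \<open>d\<close>. Each
  increase of \<open>d\<close> therefore adds at most \<open>card B\<close> to the dimension.
\<close>

lemma M_span_bound:
  assumes "finite B" and B: "\<And>d P. P \<in> M d \<Longrightarrow> P 0 \<in> E.span B"
  shows "\<exists>S. finite S \<and> card S \<le> d * card B \<and> M d \<subseteq> P.span S"
proof (induction d)
  case 0
  have "M 0 \<subseteq> {0}"
    by (auto simp: commuting_polys_def fun_eq_iff)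
  then show ?case
    by (intro exI[of _ "{}"]) auto
next
  case (Suc d)
  then obtain S where S: "finite S" "card S \<le> d * card B" "M d \<subseteq> P.span S" by blast
  obtain D where D: "D \<subseteq> (\<lambda>P. P 0) ` M (Suc d)" "E.independent D"
    "(\<lambda>P. P 0) ` M (Suc d) \<subseteq> E.span D"
    by (rule E.basis_exists)
  have "D \<subseteq> E.span B"
    using D(1) B by blast
  then have fin: "finite D" and card: "card D \<le> card B"
    using E.independent_span_bound[OF \<open>finite B\<close> D(2)] by auto
  have "\<forall>b\<in>D. \<exists>P. P \<in> M (Suc d) \<and> P 0 = b"
    using D(1) by blast
  then obtain l where l: "\<And>b. b \<in> D \<Longrightarrow> l b \<in> M (Suc d) \<and> l b 0 = b"
    by metis
  let ?S = "l ` D \<union> tshift ` S"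
  have T_span: "tshift Q \<in> P.span (tshift ` S)" if "Q \<in> P.span S" for Q
    using that
  proof (induction rule: P.span_induct_alt)
    case base
    have "tshift (0 :: nat \<Rightarrow> 'b \<Rightarrow> 'b) = 0"
      by (auto simp: tshift_def fun_eq_iff split: nat.split)
    then show ?case by (simp only: P.span_zero)
  next
    case (step r P Q)
    have "tshift (poly_scale scale r P + Q) = poly_scale scale r (tshift P) + tshift Q"
      by (intro ext) (simp add: tshift_add tshift_scale poly_scale_apply)
    then show ?case
      using step by (metis P.span_add P.span_scale P.span_base imageI)
  qed
  \<comment> \<open>subtract the lift of the constant term and divide by \<open>t\<close>\<close>
  have "P \<in> P.span ?S" if P: "P \<in> M (Suc d)" for P
  proof -
    obtain q where q: "P 0 = (\<Sum>b\<in>D. End_scale scale (q b) b)"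
    proof -
      have "P 0 \<in> E.span D" using D(3) P by blast
      then show ?thesis
        unfolding E.span_finite[OF fin] using that by blast
    qed
    define A where "A = (\<Sum>b\<in>D. poly_scale scale (q b) (l b))"
    have A: "A \<in> M (Suc d)"
      unfolding A_def using l
      by (intro P.subspace_sum[OF subspace_M] P.subspace_scale[OF subspace_M]) blast
    have A0: "A 0 = P 0"
      by (rule ext) (simp add: A_def q sum_fun_apply poly_scale_apply End_scale_def l cong: sum.cong)
    have PA: "P - A \<in> M (Suc d)"
      by (rule P.subspace_diff[OF subspace_M P A])
    define Q where "Q = (\<lambda>m. (P - A) (Suc m))"
    have Q: "P - A = tshift Q"
    proof
      show "(P - A) m = tshift Q m" for m
        using A0 by (cases m) (auto simp: Q_def)
    qed
    then have "Q \<in> M d"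
      using PA tshift_M_iff by simp
    then have "tshift Q \<in> P.span ?S"
      using S(3) T_span P.span_mono[of "tshift ` S" ?S] by blast
    moreover have "A \<in> P.span ?S"
      unfolding A_def by (intro P.span_sum P.span_scale P.span_base) auto
    ultimately have "tshift Q + A \<in> P.span ?S"
      by (rule P.span_add)
    then show ?thesis using Q by (metis diff_add_cancel)
  qed
  moreover have "card ?S \<le> Suc d * card B"
    using card_Un_le[of "l ` D" "tshift ` S"] card_image_le[OF fin, of l] card
      card_image_le[OF S(1), of tshift] S(2) by simp
  ultimately show ?case
    using fin S(1) by (intro exI[of _ ?S]) auto
qed

text \<open>
  Associativity, in the form \<open>x (P x) = (x P) x\<close>.
\<close>

lemma pencil_left_right: "(\<And>m. P m \<in> gl scale) \<Longrightarrow> L (R P) m x = R (L P) m x"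
proof -
  assume P: "\<And>m. P m \<in> gl scale"
  have T: "tshift (R P) = R (tshift P)" "tshift (L P) = L (tshift P)" for P
    by (intro ext; simp add: pencil_tshift)+
  show "L (R P) m x = R (L P) m x"
    unfolding pencil_left_def[of e y z "R P"] pencil_right_def[of e y z "L P"] T
    by (simp add: pencil_left_def pencil_right_def gl_add e y z)
qed

text \<open>The powers of \<open>x = e + t y + t\<^sup>2 z\<close>.\<close>

definition xpow :: "nat \<Rightarrow> nat \<Rightarrow> 'b \<Rightarrow> 'b" where
  "xpow i = (L ^^ i) (\<lambda>m. if m = 0 then id else 0)"

lemma L_gl:
  assumes "\<And>m. P m \<in> gl scale"
  shows "L P m \<in> gl scale"
proof -
  have t: "tshift P m \<in> gl scale" if "\<And>m. P m \<in> gl scale" for P m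
    using that by (cases m) (simp_all add: zero_in_gl)
  have "L P m = (e \<circ> P m) + (y \<circ> tshift P m) + (z \<circ> tshift (tshift P) m)"
    by (auto simp: pencil_left_def)
  then show ?thesis
    by (simp only:) (intro gl_plus gl_comp e y z assms t)
qed

lemma L_M:
  assumes P: "P \<in> M (Suc d)"
  shows "L P \<in> M (Suc (Suc (Suc d)))"
proof (rule M_I)
  show "L P m \<in> gl scale" for m
    by (intro L_gl M_coeff_gl[OF P])
  show "L P m x = 0" if "Suc (Suc (Suc d)) \<le> m" for m x
  proof -
    define l where "l = m - 2"
    have l: "m = Suc (Suc l)" "Suc d \<le> l"
      using that by (auto simp: l_def)
    then show ?thesis
      by (simp add: pencil_left_def M_degree[OF P] gl_zero e y z)
  qed
  show "L (L P) m x = R (L P) m x" for m x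
  proof -
    have "L P = R P" using M_commute[OF P] by (intro ext)
    then have "L (L P) m x = L (R P) m x" by simp
    then show ?thesis
      using pencil_left_right[of P] M_coeff_gl[OF P] by simp
  qed
qed

lemma xpow_M: "xpow i \<in> M (Suc (2 * i))"
proof (induction i)
  case 0
  show ?case
  proof (rule M_I)
    show "xpow 0 m \<in> gl scale" for m
      by (simp add: xpow_def zero_in_gl) (simp add: gl_iff)
    show "xpow 0 m x = 0" if "Suc (2 * 0) \<le> m" for m x
      using that by (simp add: xpow_def)
    show "L (xpow 0) m x = R (xpow 0) m x" for m x
      by (simp add: xpow_def pencil_left_def pencil_right_def tshift_def gl_zero e y z
          split: nat.split)
  qed
next
  case (Suc i)
  have "xpow (Suc i) = L (xpow i)"
    by (simp add: xpow_def)
  then show ?case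
    using L_M[OF Suc.IH] by simp
qed

text \<open>
  The power \<open>x ^ i\<close> has degree at most \<open>2 i\<close> in \<open>t\<close>, with \<open>z ^ i\<close> as coefficient of \<open>t ^ (2 i)\<close>; the
  shift \<open>z\<close> carries \<open>u 0\<close> to \<open>u i\<close> in \<open>i\<close> steps.
\<close>

lemma xpow_top: "i < n \<Longrightarrow> xpow i (2 * i) (u 0) = u i"
proof (induction i)
  case 0
  then show ?case by (simp add: xpow_def)
next
  case (Suc i)
  have "xpow (Suc i) (2 * Suc i) (u 0)
      = e (xpow i (Suc (Suc (2 * i))) (u 0)) + y (xpow i (Suc (2 * i)) (u 0)) + z (xpow i (2 * i) (u 0))"
    by (simp add: xpow_def pencil_left_def)
  also have "\<dots> = u (Suc i)"
    using Suc by (simp add: M_degree[OF xpow_M] gl_zero e y z_basis)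
  finally show ?case .
qed

text \<open>
  In a linear relation between the \<open>t ^ j x ^ i\<close>, let \<open>D\<close> be the largest \<open>j + 2 i\<close> that occurs. The
  coefficient of \<open>t ^ D\<close>, applied to \<open>u 0\<close>, is a relation between distinct basis vectors \<open>u i\<close>, one
  for each occurring pair with \<open>j + 2 i = D\<close>.
\<close>

lemma shifted_powers_independent:
  assumes "finite A" and A: "A \<subseteq> {..<n} \<times> UNIV"
    and zero: "(\<Sum>(i, j)\<in>A. poly_scale scale (q (i, j)) ((tshift ^^ j) (xpow i))) = 0"
    and a: "a \<in> A"
  shows "q a = 0"
proof (rule ccontr)
  assume "q a \<noteq> 0"
  define N where "N = {p \<in> A. q p \<noteq> 0}"
  have "a \<in> N"
    using a \<open>q a \<noteq> 0\<close> by (simp add: N_def)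
  then have "N \<noteq> {}"
    by blast
  moreover have "finite N"
    using \<open>finite A\<close> by (simp add: N_def)
  ultimately have N: "finite N" "N \<noteq> {}"
    by simp_all
  define deg where "deg = (\<lambda>(i, j). j + 2 * i :: nat)"
  define D where "D = Max (deg ` N)"
  have "D \<in> deg ` N"
    unfolding D_def using N by (intro Max_in) simp_all
  then obtain p0 where "p0 \<in> N" "deg p0 = D"
    by blast
  moreover obtain i0 j0 where "p0 = (i0, j0)"
    by (cases p0)
  ultimately have p0: "(i0, j0) \<in> N" "deg (i0, j0) = D"
    by simp_all
  have le: "deg p \<le> D" if "p \<in> N" for p
    using that N by (simp add: D_def)
  have i0: "i0 < n" using p0 A by (auto simp: N_def)
  have contrib: "c i0 (scale (q p) ((tshift ^^ snd p) (xpow (fst p)) D (u 0)))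
      = (if p = (i0, j0) then q p else 0)" if p: "p \<in> A" for p
  proof (cases "q p = 0")
    case True
    then show ?thesis using i0 by (auto simp: coord_zero)
  next
    case False
    obtain i j where ij: "p = (i, j)" by (cases p)
    have "p \<in> N" using p False by (simp add: N_def)
    then have dp: "j + 2 * i \<le> D" using le[of p] by (simp add: ij deg_def)
    have i: "i < n" using p A ij by auto
    show ?thesis
    proof (cases "j + 2 * i = D")
      case True
      then have "(tshift ^^ j) (xpow i) D (u 0) = u i"
        using xpow_top[OF i] by (auto simp: tshift_power)
      moreover have "i = i0 \<longleftrightarrow> p = (i0, j0)"
        using True p0(2) by (auto simp: ij deg_def)
      ultimately show ?thesis
        using i i0 by (auto simp: ij coord_scale coord_basis)
    next
      case False
      then have "Suc (2 * i) \<le> D - j" using dp by simp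
      then have "(tshift ^^ j) (xpow i) D (u 0) = 0"
        using M_degree[OF xpow_M] dp by (simp add: tshift_power)
      moreover have "p \<noteq> (i0, j0)"
        using False p0(2) by (auto simp: ij deg_def)
      ultimately show ?thesis
        using i0 by (auto simp: ij coord_zero)
    qed
  qed
  have "0 = c i0 ((\<Sum>(i, j)\<in>A. poly_scale scale (q (i, j)) ((tshift ^^ j) (xpow i))) D (u 0))"
    using i0 by (simp add: zero coord_zero)
  also have "\<dots> = (\<Sum>p\<in>A. c i0 (scale (q p) ((tshift ^^ snd p) (xpow (fst p)) D (u 0))))"
    using i0 by (simp add: sum_fun_apply coord_sum case_prod_unfold poly_scale_apply)
  also have "\<dots> = (\<Sum>p\<in>A. if p = (i0, j0) then q p else 0)"
    by (rule sum.cong) (auto simp: contrib)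
  also have "\<dots> = q (i0, j0)"
    using p0 \<open>finite A\<close> by (simp add: N_def)
  finally show False
    using p0 by (simp add: N_def)
qed

text \<open>
  The count is of commuting polynomials of degree less than \<open>2 n + N\<close>. There are \<open>n (N + 1)\<close>
  independent ones \<open>t ^ j x ^ i\<close>, but at most \<open>(2 n + N) card B\<close> in all. For large \<open>N\<close> the growth
  rate in \<open>N\<close> decides, and \<open>N = 2 n\<^sup>2\<close> suffices.
\<close>

lemma many_constant_terms:
  assumes "finite B" and B: "\<And>d P. P \<in> M d \<Longrightarrow> P 0 \<in> E.span B"
  shows "n \<le> card B"
proof (rule ccontr)
  assume "\<not> n \<le> card B"
  then have lt: "card B < n" by simp
  define N where "N = 2 * n * n"
  define A where "A = {..<n} \<times> {..N}"
  obtain S where S: "finite S" "card S \<le> (2 * n + N) * card B" "M (2 * n + N) \<subseteq> P.span S"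
    using M_span_bound[OF \<open>finite B\<close>, of "2 * n + N"] B by blast
  have "card A \<le> card S"
  proof (rule P.card_le_of_independent_family)
    show "finite A" "finite S"
      using S by (simp_all add: A_def)
    show "(\<lambda>(i, j). (tshift ^^ j) (xpow i)) ` A \<subseteq> P.span S"
    proof (clarify)
      fix i j assume "(i, j) \<in> A"
      then have "Suc (2 * i) + j \<le> 2 * n + N"
        by (auto simp: A_def)
      then have "(tshift ^^ j) (xpow i) \<in> M (2 * n + N)"
        using tshift_power_M[OF xpow_M, of j i] M_mono by blast
      then show "(tshift ^^ j) (xpow i) \<in> P.span S"
        using S by blast
    qed
    show "q a = 0" if "(\<Sum>a\<in>A. poly_scale scale (q a) (case a of (i, j) \<Rightarrow> (tshift ^^ j) (xpow i))) = 0"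
      and "a \<in> A" for q a
    proof (rule shifted_powers_independent[of A])
      show "(\<Sum>(i, j)\<in>A. poly_scale scale (q (i, j)) ((tshift ^^ j) (xpow i))) = 0"
        using that(1) by (simp add: case_prod_unfold)
    qed (use that in \<open>auto simp: A_def\<close>)
  qed
  then have "n * (N + 1) \<le> (2 * n + N) * card B"
    using S(2) by (simp add: A_def)
  also have "\<dots> \<le> (2 * n + N) * (n - 1)"
    using lt by (intro mult_le_mono2) simp
  finally have "n * (N + 1) + (2 * n + N) \<le> (2 * n + N) * n"
    using lt by (simp add: diff_mult_distrib2)
  then show False
    using lt by (simp add: N_def algebra_simps)
qed

lemma constant_term_centralises: "P \<in> M d \<Longrightarrow> P 0 \<in> centraliser scale e"
  using M_commute[of P d 0] M_coeff_gl[of P d 0]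
  by (auto simp: centraliser_def commutator_def fun_eq_iff pencil_left_def pencil_right_def
      gl_zero y z)

text \<open>
  The coefficient of \<open>t\<close> in \<open>x P = P x\<close> reads \<open>[y, P 0] = - [e, P 1]\<close>. By invariance of the trace
  form, pairing \<open>y\<close> with \<open>[P 0, h]\<close> is the same as pairing \<open>[y, P 0]\<close> with \<open>h\<close>, hence as pairing
  \<open>- P 1\<close> with \<open>[h, e]\<close>, which vanishes for \<open>h\<close> in the centraliser of \<open>e\<close>.
\<close>

lemma constant_term_stabilises:
  assumes P: "P \<in> M d" and h: "h \<in> centraliser scale e"
  shows "trace (y \<circ> commutator (P 0) h) = 0"
proof -
  have h_gl: "h \<in> gl scale" and eh: "e \<circ> h = h \<circ> e"
    using h by (auto simp: centraliser_def commutator_def)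
  note gls = M_coeff_gl[OF P] h_gl e y
  have first_order: "y (P 0 x) + e (P 1 x) = P 0 (y x) + P 1 (e x)" for x
    using M_commute[OF P, of 1 x] by (simp add: pencil_left_def pencil_right_def gl_zero z add.commute)
  have "y \<circ> commutator (P 0) h = (y \<circ> P 0 \<circ> h) - ((y \<circ> h) \<circ> P 0)"
    by (auto simp: commutator_def gl_diff[OF y])
  then have "trace (y \<circ> commutator (P 0) h) = trace (y \<circ> P 0 \<circ> h) - trace ((y \<circ> h) \<circ> P 0)"
    by (simp only: trace_diff)
  also have "trace ((y \<circ> h) \<circ> P 0) = trace (P 0 \<circ> y \<circ> h)"
    using trace_comm[of "y \<circ> h" "P 0"] by (simp add: gl_comp gls comp_assoc)
  finally have 1: "trace (y \<circ> commutator (P 0) h) = trace (y \<circ> P 0 \<circ> h) - trace (P 0 \<circ> y \<circ> h)" .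
  have "(y \<circ> P 0 \<circ> h) + (e \<circ> P 1 \<circ> h) = (P 0 \<circ> y \<circ> h) + (P 1 \<circ> e \<circ> h)"
    using first_order by (auto simp: fun_eq_iff)
  then have 2: "trace (y \<circ> P 0 \<circ> h) + trace (e \<circ> P 1 \<circ> h) = trace (P 0 \<circ> y \<circ> h) + trace (P 1 \<circ> e \<circ> h)"
    by (simp only: trace_add[symmetric])
  have "trace (e \<circ> P 1 \<circ> h) = trace (P 1 \<circ> h \<circ> e)"
    using trace_comm[of e "P 1 \<circ> h"] by (simp add: gl_comp gls comp_assoc)
  also have "P 1 \<circ> h \<circ> e = P 1 \<circ> e \<circ> h"
    by (simp add: comp_assoc eh)
  finally have "trace (y \<circ> P 0 \<circ> h) = trace (P 0 \<circ> y \<circ> h)"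
    using 2 by (simp only: add_right_cancel)
  then show ?thesis
    using 1 by (simp only: diff_self)
qed

end

section \<open>The index of the centraliser\<close>

theorem mainTheorem3:
  fixes scale :: "'a::field \<Rightarrow> 'b::ab_group_add \<Rightarrow> 'b"
    and Basis :: "'b set"
    and e :: "'b \<Rightarrow> 'b"
    and n k :: nat
  assumes "finite_dimensional_vector_space scale Basis"
    and "vector_space.dim scale (UNIV :: 'b set) = n"
    and "e \<in> gl scale"
    and "nilpotent_map e"
    and "has_jordan_blocks scale e k"
    and "infinite (UNIV :: 'a set) \<or> k \<le> card (UNIV :: 'a set)"
  shows "fin_dim_lie_algebra.index (End_scale scale) (centraliser scale e) commutator = n"
proof -
  interpret V: finite_dimensional_vector_space scale Basis by fact
  interpret G: fin_dim_lie_algebra "End_scale scale" "centraliser scale e" commutator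
    using fin_dim_lie_algebra_centraliser[OF assms(1,3)] .
  obtain m u c where "jordan_basis scale k m u c e"
    using exists_jordan_basis[OF V.vector_space_axioms assms(3-5)] .
  then interpret J: jordan_basis scale k m u c e .
  let ?I = "SIGMA i:{..<k}. {..<m i}"
  have n: "card ?I = n"
    using J.dim_space assms(2) by simp
  \<comment> \<open>upper bound: one functional with a stabiliser of dimension at most \<open>n\<close>\<close>
  have "G.index \<le> n"
  proof -
    obtain a :: "nat \<Rightarrow> 'a" where a: "inj_on a {..<k}"
      "\<And>i j. \<lbrakk>i < k; j < k; a i = 0\<rbrakk> \<Longrightarrow> m i \<le> m j"
      using exists_distinct_weights[OF assms(6), of m] by blast
    have dual: "J.diag_form a \<in> G.dual"
      by (simp add: G.dual_def J.diag_form_add J.diag_form_scale)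
    have "G.index \<le> G.dim (G.stabiliser (J.diag_form a))"
      unfolding G.index_def by (rule cINF_lower[OF _ dual]) simp
    also have "\<dots> \<le> card ((\<lambda>(i, s). J.block_map i i s) ` ?I)"
    proof (rule G.dim_le_card)
      show "G.stabiliser (J.diag_form a) \<subseteq> G.span ((\<lambda>(i, s). J.block_map i i s) ` ?I)"
      proof
        fix f assume "f \<in> G.stabiliser (J.diag_form a)"
        then have f: "f \<in> centraliser scale e"
          "\<And>g. g \<in> centraliser scale e \<Longrightarrow> J.diag_form a (commutator f g) = 0"
          by (simp_all add: G.stabiliser_def)
        show "f \<in> G.span ((\<lambda>(i, s). J.block_map i i s) ` ?I)"
          by (rule J.stabiliser_span[OF a(1) _ f(1)]) (fact a(2), fact f(2))
      qed
    qed (simp add: J.finite_I)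
    also have "\<dots> \<le> n"
      using card_image_le[OF J.finite_I] n by metis
    finally show ?thesis .
  qed
  \<comment> \<open>lower bound: \<open>\<alpha>\<close> attains the minimum, but nothing else is known about it\<close>
  moreover have "n \<le> G.index"
  proof -
    obtain \<alpha> where \<alpha>: "\<alpha> \<in> G.dual" "G.dim (G.stabiliser \<alpha>) = G.index"
      using G.index_attained by blast
    obtain \<beta> where \<beta>: "\<And>f g. \<beta> (f + g) = \<beta> f + \<beta> g" "\<And>r f. \<beta> (End_scale scale r f) = r * \<beta> f"
      "\<And>f. f \<in> centraliser scale e \<Longrightarrow> \<beta> f = \<alpha> f"
      using G.extend_functional[OF G.subspace_carrier, of \<alpha>] \<alpha>(1) unfolding G.dual_def by blast
    obtain b where "bij_betw b {0..<n} ?I"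
      using ex_bij_betw_nat_finite[OF J.finite_I] n by metis
    then obtain v d where "dual_basis scale {..<n} v d"
      using J.reindex unfolding lessThan_atLeast0 by blast
    then interpret D: dual_basis scale "{..<n}" v d .
    obtain y where y: "y \<in> gl scale" "\<And>f. f \<in> gl scale \<Longrightarrow> \<beta> f = D.trace (y \<circ> f)"
      using D.functional_is_trace[OF \<beta>(1,2)] by blast
    define z where "z = (\<lambda>x. \<Sum>i\<in>{..<n - 1}. scale (d i x) (v (Suc i)))"
    have z_gl: "z \<in> gl scale"
      unfolding z_def by (rule D.linear_combination_in_gl) auto
    have z_v: "z (v i) = v (Suc i)" if "Suc i < n" for i
    proof -
      have "z (v i) = (\<Sum>j\<in>{..<n - 1}. if j = i then v (Suc j) else 0)"
        unfolding z_def using that by (intro sum.cong) (auto simp: D.coord_basis)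
      then show ?thesis using that by auto
    qed
    interpret S: pencil scale n v d e y z
      by unfold_locales (use assms(3) y(1) z_gl z_v in auto)
    obtain B where B: "B \<subseteq> G.stabiliser \<alpha>" "G.independent B" "G.stabiliser \<alpha> \<subseteq> G.span B"
      "card B = G.dim (G.stabiliser \<alpha>)"
      by (rule G.basis_exists)
    have "finite B"
    proof -
      obtain T where T: "finite T" "centraliser scale e \<subseteq> G.span T"
        using G.finite_dimensional by blast
      have "B \<subseteq> G.span T"
        using B(1) T(2) by (auto simp: G.stabiliser_def)
      then show ?thesis
        using G.independent_span_bound[OF T(1) B(2)] by blast
    qed
    have P0: "P 0 \<in> G.span B" if P: "P \<in> S.M t" for P t
    proof -
      have "\<alpha> (commutator (P 0) h) = 0" if h: "h \<in> centraliser scale e" for h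
      proof -
        have c: "commutator (P 0) h \<in> centraliser scale e"
          by (rule G.br_closed[OF S.constant_term_centralises[OF P] h])
        then have "commutator (P 0) h \<in> gl scale"
          by (simp add: centraliser_def)
        then show ?thesis
          using \<beta>(3)[OF c] y(2) S.constant_term_stabilises[OF P h] by simp
      qed
      then have "P 0 \<in> G.stabiliser \<alpha>"
        using S.constant_term_centralises[OF P] by (simp add: G.stabiliser_def)
      then show ?thesis using B(3) by blast
    qed
    have "n \<le> card B"
      using S.many_constant_terms[OF \<open>finite B\<close>] P0 by blast
    then show ?thesis using B(4) \<alpha>(2) by simp
  qed
  ultimately show ?thesis by simp
qed

end
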